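(* Suppose that Assumptions A, B, C, D, E (spelled out in the context) hold, $L<\gamma_{\min}\leq\gamma_k\leq\gamma_{\max}<\infty$ and $0\leq\sigma<(\gamma_{\min}-L)/\gamma_{\max}$ for all $k\geq0$, and $\sum_{k=0}^{\infty}\|\Delta^k\|<\infty$. Let $\{\bm{x}^k\}$ be the sequence generated by the iBPDCA with (SC2). For $\tau>0$ let $H_\tau(\bm{u},\bm{v}):=F(\bm{u})+\frac{\tau}{2}\|\bm{u}-\bm{v}\|^2$ for $\bm{u},\bm{v}\in\mathbb{E}$. If $H_\tau$ is a KL function for any $\tau>0$, then the sequence $\{\bm{x}^k\}$ converges to an $\ell$-stationary point of the problem $\min_{\bm{x}\in\mathcal{Q}} f(\bm{x})+P_1(\bm{x})-P_2(\bm{x})$ for sufficiently small $\sigma$.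
   Context: Setting. $\mathbb{E}$ is a real finite-dimensional Euclidean space with inner product $\langle\cdot,\cdot\rangle$ and induced norm $\|\cdot\|$; $\mathcal{Q}\subseteq\mathbb{E}$ is a closed convex set with nonempty interior; the problem is $\min_{\bm{x}\in\mathcal{Q}} f(\bm{x})+P_1(\bm{x})-P_2(\bm{x})$. $\iota_{\mathcal{Q}}$ is the indicator function of $\mathcal{Q}$ ($0$ on $\mathcal{Q}$, $+\infty$ elsewhere). For a proper closed convex function $h$, $\bm{x}\in\mathrm{dom}\,h$ and $\varepsilon\ge 0$, $\partial_\varepsilon h(\bm{x})=\{\bm{d}: h(\bm{y})\ge h(\bm{x})+\langle\bm{d},\bm{y}-\bm{x}\rangle-\varepsilon\ \forall\bm{y}\in\mathbb{E}\}$ and $\partial h=\partial_0 h$. For a general proper function $h$ and $\bm{x}\in\mathrm{dom}\,h$, $\partial h(\bm{x})$ is the limiting subdifferential: the set of $\bm{d}$ for which there are $\bm{x}^k\to\bm{x}$ with $h(\bm{x}^k)\to h(\bm{x})$ and $\bm{d}^k\to\bm{d}$ with $\liminf_{\bm{y}\to\bm{x}^k,\bm{y}\ne\bm{x}^k}\frac{h(\bm{y})-h(\bm{x}^k)-\langle\bm{d}^k,\bm{y}-\bm{x}^k\rangle}{\|\bm{y}-\bm{x}^k\|}\ge0$ for all $k$ (it coincides with the convex subdifferential for convex $h$). Kernel and Bregman distance. $\phi:\mathbb{E}\to(-\infty,\infty]$ is a proper closed kernel function, and $\mathcal{D}_\phi(\bm{x},\bm{y})=\phi(\bm{x})-\phi(\bm{y})-\langle\nabla\phi(\bm{y}),\bm{x}-\bm{y}\rangle$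 for $\bm{x}\in\mathrm{dom}\,\phi$, $\bm{y}\in\mathrm{int}\,\mathrm{dom}\,\phi$. A function $h$ is essentially smooth if $\mathrm{int}\,\mathrm{dom}\,h\neq\emptyset$, $h$ is differentiable on $\mathrm{int}\,\mathrm{dom}\,h$, and $\|\nabla h(\bm{x}^k)\|\to\infty$ for every sequence in $\mathrm{int}\,\mathrm{dom}\,h$ converging to a boundary point of $\mathrm{int}\,\mathrm{dom}\,h$. For a closed set $\mathcal{X}$ with $\mathcal{X}\cap\mathrm{int}\,\mathrm{dom}\,\phi\ne\emptyset$, $(f,\phi)$ is $L$-smooth adaptable restricted on $\mathcal{X}$ ($L\ge 0$) if $|f(\bm{y})-f(\bm{x})-\langle\nabla f(\bm{x}),\bm{y}-\bm{x}\rangle|\le L\mathcal{D}_\phi(\bm{y},\bm{x})$ for all $\bm{x}\in\mathcal{X}\cap\mathrm{int}\,\mathrm{dom}\,\phi$ and $\bm{y}\in\mathcal{X}\cap\mathrm{dom}\,\phi$. Assumption A. (A1) $\phi$ is essentially smooth and strictly convex on $\mathrm{dom}\,\phi$, and $\overline{\mathrm{dom}\,\phi}=\mathcal{Q}$. (A2) $P_1:\mathbb{E}\to(-\infty,\infty]$ is proper closed convex with $\mathrm{dom}\,P_1\cap\mathrm{int}\,\mathcal{Q}\ne\emptyset$; $P_2:\mathbb{E}\to\mathbb{R}$ is continuous and convex. (A3) $f:\mathbb{E}\to(-\infty,\infty]$ is proper closed (possibly nonconvex) with $\mathrm{dom}\,f\supseteq\mathrm{dom}\,\phi$, $f$ is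 continuously differentiable on $\mathrm{int}\,\mathrm{dom}\,f$, and there is a closed set $\mathcal{X}\supseteq\mathrm{dom}\,P_1\cap\mathcal{Q}$ such that $(f,\phi)$ is $L$-smooth adaptable restricted on $\mathcal{X}$. (A4) $F:=\iota_{\mathcal{Q}}+P_1-P_2+f$ is level-bounded: $\{\bm{x}: F(\bm{x})\le\alpha\}$ is bounded (possibly empty) for every $\alpha\in\mathbb{R}$. (A5) For each subproblem $\min_{\bm{x}} P_1(\bm{x})+\langle\nabla f(\bm{x}^k)-\bm{\xi}^k,\bm{x}-\bm{x}^k\rangle+\gamma_k\mathcal{D}_\phi(\bm{x},\bm{x}^k)$ of the algorithm below, the set of optimal solutions is nonempty and contained in $\mathrm{int}\,\mathrm{dom}\,\phi$. Assumption B. $f$ is continuously differentiable on an open set $\mathcal{N}_f$ containing $\mathrm{dom}\,P_1\cap\mathcal{Q}$. Assumption C. There is an open set $\mathcal{N}_\phi$ with $\mathrm{dom}\,P_1\cap\mathcal{Q}\subseteq\mathcal{N}_\phi\subseteq\mathrm{int}\,\mathrm{dom}\,\phi$ such that (C1) $\phi$ is $\mu$-strongly convex on $\mathcal{N}_\phi$ (for some $\mu>0$); (C2) $\phi$ is differentiable on $\mathcal{N}_\phi$ and $\nabla\phi$ is Lipschitz continuous on any bounded subset of $\mathcal{N}_\phi$. Stationarity. $\bm{x}^*$ is a stationary point if $0\in\partial(\iota_{\mathcal{Q}}+P_1)(\bm{x}^* )-\partial P_2(\bm{x}^* )+\nabla f(\bm{x}^* )$; $\mathcal{S}$ denotes the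 set of all stationary points. If $P_2$ is continuously differentiable near $\bm{x}^*$, then $\bm{x}^*$ is an $\ell$-stationary (limiting stationary) point if $0\in\partial(\iota_{\mathcal{Q}}+P_1)(\bm{x}^* )-\nabla P_2(\bm{x}^* )+\nabla f(\bm{x}^* )$. Assumption D. (D1) $\nabla f$ is Lipschitz continuous on any bounded subset of $\mathcal{N}_f$. (D2) $P_2$ is continuously differentiable on an open set $\mathcal{N}_{\mathcal{S}}$ containing $\mathcal{S}$, and $\nabla P_2$ is locally Lipschitz continuous on $\mathcal{N}_{\mathcal{S}}$. Assumption E. There is $K_0>0$ such that $\delta_k=0$ for all $k\ge K_0$ in the algorithm below. Algorithm (iBPDCA, the inexact Bregman proximal difference-of-convex algorithm, with (SC2)). Choose $\bm{x}^0\in\mathrm{dom}\,P_1\cap\mathrm{int}\,\mathrm{dom}\,\phi$, $\bm{x}^{-1}\in\mathrm{int}\,\mathrm{dom}\,\phi$ and parameters $\{\gamma_k\}$, $\sigma$ as in the claim. For $k=0,1,2,\dots$: take any $\bm{\xi}^k\in\partial P_2(\bm{x}^k)$ and, by approximately solving the subproblem in (A5), find $\bm{x}^{k+1}\in\mathrm{dom}\,P_1\cap\mathrm{int}\,\mathrm{dom}\,\phi$ with an error pair $(\Delta^k,\delta_k)$, $\Delta^k\in\mathbb{E}$, $\delta_k\ge0$, such that $$\Delta^k\in\partial_{\delta_k}P_1(\bm{x}^{k+1})+\nabla f(\bm{x}^k)-\bm{\xi}^k+\gamma_k\big(\nabla\phi(\bm{x}^{k+1})-\nabla\phi(\bm{x}^k)\big)$$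 and (SC2) $\|\Delta^k\|^2+|\langle\Delta^k,\bm{x}^{k+1}-\bm{x}^k\rangle|+\delta_k\le\sigma\gamma_k\mathcal{D}_\phi(\bm{x}^{k},\bm{x}^{k-1})$. KL functions. For $\nu>0$, $\Xi_\nu$ is the class of concave functions $\varphi:[0,\nu)\to\mathbb{R}_+$ with $\varphi(0)=0$, $\varphi$ continuously differentiable on $(0,\nu)$ and continuous at $0$, and $\varphi'>0$ on $(0,\nu)$. A proper closed function $h$ has the KL (Kurdyka-Łojasiewicz) property at $\tilde{\bm{x}}\in\mathrm{dom}\,\partial h:=\{\bm{x}:\partial h(\bm{x})\neq\emptyset\}$ if there are $\nu\in(0,+\infty]$, a neighborhood $\mathcal{V}$ of $\tilde{\bm{x}}$ and $\varphi\in\Xi_\nu$ such that $\varphi'(h(\bm{x})-h(\tilde{\bm{x}}))\,\mathrm{dist}(0,\partial h(\bm{x}))\ge1$ for all $\bm{x}\in\mathcal{V}$ with $h(\tilde{\bm{x}})<h(\bm{x})<h(\tilde{\bm{x}})+\nu$; here $\mathrm{dist}(0,\mathcal{C})=\inf_{\bm{y}\in\mathcal{C}}\|\bm{y}\|$. $h$ is a KL function if it has the KL property at each point of $\mathrm{dom}\,\partial h$. *)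

theory Defs
  imports "HOL-Analysis.Analysis"
begin

section \<open>Extended-real-valued functions\<close>

definition edom :: "('a \<Rightarrow> ereal) \<Rightarrow> 'a set" where
  "edom h = {x. h x < \<infinity>}"

definition proper_fun :: "('a \<Rightarrow> ereal) \<Rightarrow> bool" where
  "proper_fun h \<longleftrightarrow> (\<forall>x. h x \<noteq> -\<infinity>) \<and> edom h \<noteq> {}"

definition epi :: "('a \<Rightarrow> ereal) \<Rightarrow> ('a \<times> real) set" where
  "epi h = {(x, r). h x \<le> ereal r}"

definition closed_fun :: "('a::topological_space \<Rightarrow> ereal) \<Rightarrow> bool" where
  "closed_fun h \<longleftrightarrow> closed (epi h)"

definition convex_fun :: "('a::real_vector \<Rightarrow> ereal) \<Rightarrow> bool" where
  "convex_fun h \<longleftrightarrow> convex (epi h)"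

definition indicator_fun :: "'a set \<Rightarrow> 'a \<Rightarrow> ereal" where
  "indicator_fun Q x = (if x \<in> Q then 0 else \<infinity>)"

definition level_bounded :: "('a::metric_space \<Rightarrow> ereal) \<Rightarrow> bool" where
  "level_bounded h \<longleftrightarrow> (\<forall>\<alpha>::real. bounded {x. h x \<le> ereal \<alpha>})"

definition strictly_convex_on :: "'a::real_vector set \<Rightarrow> ('a \<Rightarrow> ereal) \<Rightarrow> bool" where
  "strictly_convex_on S h \<longleftrightarrow> convex S \<and>
     (\<forall>x\<in>S. \<forall>y\<in>S. \<forall>t::real. x \<noteq> y \<longrightarrow> 0 < t \<longrightarrow> t < 1 \<longrightarrow>
        h (t *\<^sub>R x + (1 - t) *\<^sub>R y) < ereal t * h x + ereal (1 - t) * h y)"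

text \<open>The set \<open>N\<close> is not required to be convex, so the inequality is imposed on the segments
  contained in \<open>N\<close>; for convex \<open>N\<close> this is the usual notion.\<close>

definition strongly_convex_on :: "real \<Rightarrow> 'a::real_normed_vector set \<Rightarrow> ('a \<Rightarrow> ereal) \<Rightarrow> bool" where
  "strongly_convex_on \<mu> N h \<longleftrightarrow>
     (\<forall>x y. closed_segment x y \<subseteq> N \<longrightarrow> (\<forall>t\<in>{0..1::real}.
        h (t *\<^sub>R x + (1 - t) *\<^sub>R y)
          \<le> ereal t * h x + ereal (1 - t) * h y - ereal (\<mu> / 2 * t * (1 - t) * (norm (x - y))\<^sup>2)))"

section \<open>Gradients\<close>

text \<open>\<open>real_of_ereal\<close> sends \<open>\<infinity>\<close> to \<open>0\<close>; differentiability is therefore only considered in the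
  interior of the domain, where a proper function is finite near the point. Outside the points of
  differentiability \<open>grad\<close> carries no information.\<close>

definition grad :: "('a::real_inner \<Rightarrow> ereal) \<Rightarrow> 'a \<Rightarrow> 'a" where
  "grad h x = (THE g. GDERIV (\<lambda>y. real_of_ereal (h y)) x :> g)"

definition diff_at :: "('a::real_inner \<Rightarrow> ereal) \<Rightarrow> 'a \<Rightarrow> bool" where
  "diff_at h x \<longleftrightarrow>
     x \<in> interior (edom h) \<and> (\<exists>g. GDERIV (\<lambda>y. real_of_ereal (h y)) x :> g)"

definition cont_diff_on :: "('a::real_inner \<Rightarrow> ereal) \<Rightarrow> 'a set \<Rightarrow> bool" where
  "cont_diff_on h U \<longleftrightarrow> (\<forall>x\<in>U. diff_at h x) \<and> continuous_on U (grad h)"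

definition lipschitz_on_bounded_subsets ::
    "('a::metric_space \<Rightarrow> 'b::metric_space) \<Rightarrow> 'a set \<Rightarrow> bool" where
  "lipschitz_on_bounded_subsets g N \<longleftrightarrow> (\<forall>B\<subseteq>N. bounded B \<longrightarrow> (\<exists>M. M-lipschitz_on B g))"

definition locally_lipschitz_on ::
    "('a::metric_space \<Rightarrow> 'b::metric_space) \<Rightarrow> 'a set \<Rightarrow> bool" where
  "locally_lipschitz_on g N \<longleftrightarrow> (\<forall>x\<in>N. \<exists>e>0. \<exists>M. M-lipschitz_on (ball x e \<inter> N) g)"

definition essentially_smooth :: "('a::euclidean_space \<Rightarrow> ereal) \<Rightarrow> bool" where
  "essentially_smooth h \<longleftrightarrow>
     interior (edom h) \<noteq> {} \<and>
     (\<forall>x\<in>interior (edom h). diff_at h x) \<and>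
     (\<forall>(u :: nat \<Rightarrow> 'a) b. (\<forall>k. u k \<in> interior (edom h)) \<longrightarrow>
        b \<in> frontier (interior (edom h)) \<longrightarrow> u \<longlonglongrightarrow> b \<longrightarrow>
        filterlim (\<lambda>k. norm (grad h (u k))) at_top sequentially)"

section \<open>Subdifferentials\<close>

definition eps_subdiff :: "real \<Rightarrow> ('a::real_inner \<Rightarrow> ereal) \<Rightarrow> 'a \<Rightarrow> 'a set" where
  "eps_subdiff \<epsilon> h x =
     {d. x \<in> edom h \<and> (\<forall>y. h y \<ge> h x + ereal (d \<bullet> (y - x)) - ereal \<epsilon>)}"

abbreviation convex_subdiff :: "('a::real_inner \<Rightarrow> ereal) \<Rightarrow> 'a \<Rightarrow> 'a set" where
  "convex_subdiff \<equiv> eps_subdiff 0"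

definition frechet_subdiff :: "('a::real_inner \<Rightarrow> ereal) \<Rightarrow> 'a \<Rightarrow> 'a set" where
  "frechet_subdiff h x =
     {d. x \<in> edom h \<and>
         Liminf (at x) (\<lambda>y. (h y - h x - ereal (d \<bullet> (y - x))) / ereal (norm (y - x))) \<ge> 0}"

definition limiting_subdiff :: "('a::real_inner \<Rightarrow> ereal) \<Rightarrow> 'a \<Rightarrow> 'a set" where
  "limiting_subdiff h x =
     {d. x \<in> edom h \<and>
         (\<exists>(u :: nat \<Rightarrow> 'a) (v :: nat \<Rightarrow> 'a).
            u \<longlonglongrightarrow> x \<and> (\<lambda>k. h (u k)) \<longlonglongrightarrow> h x \<and> v \<longlonglongrightarrow> d \<and>
            (\<forall>k. v k \<in> frechet_subdiff h (u k)))}"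

section \<open>Bregman distance and relative smoothness\<close>

definition bregman :: "('a::real_inner \<Rightarrow> ereal) \<Rightarrow> 'a \<Rightarrow> 'a \<Rightarrow> ereal" where
  "bregman \<phi> x y = \<phi> x - \<phi> y - ereal (grad \<phi> y \<bullet> (x - y))"

definition smooth_adaptable ::
    "real \<Rightarrow> ('a::euclidean_space \<Rightarrow> ereal) \<Rightarrow> ('a \<Rightarrow> ereal) \<Rightarrow> 'a set \<Rightarrow> bool" where
  "smooth_adaptable L f \<phi> X \<longleftrightarrow>
     closed X \<and> X \<inter> interior (edom \<phi>) \<noteq> {} \<and>
     (\<forall>x \<in> X \<inter> interior (edom \<phi>). \<forall>y \<in> X \<inter> edom \<phi>.
        \<bar>f y - f x - ereal (grad f x \<bullet> (y - x))\<bar> \<le> ereal L * bregman \<phi> y x)"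

section \<open>KL functions\<close>

definition KL_interval :: "ereal \<Rightarrow> real set" where
  "KL_interval \<nu> = {t. 0 \<le> t \<and> ereal t < \<nu>}"

definition KL_desingularizing :: "ereal \<Rightarrow> (real \<Rightarrow> real) set" where
  "KL_desingularizing \<nu> = {\<psi>.
     concave_on (KL_interval \<nu>) \<psi> \<and>
     (\<forall>t\<in>KL_interval \<nu>. 0 \<le> \<psi> t) \<and>
     \<psi> 0 = 0 \<and>
     (\<forall>t\<in>KL_interval \<nu> - {0}. \<psi> differentiable (at t)) \<and>
     continuous_on (KL_interval \<nu> - {0}) (deriv \<psi>) \<and>
     continuous (at 0 within KL_interval \<nu>) \<psi> \<and>
     (\<forall>t\<in>KL_interval \<nu> - {0}. 0 < deriv \<psi> t)}"

text \<open>\<open>dist0 {} = \<infinity>\<close>, the convention \<open>inf {} = \<infinity>\<close> (in contrast to \<open>infdist\<close>, which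
  would give \<open>0\<close>).\<close>

definition dist0 :: "'a::real_normed_vector set \<Rightarrow> ereal" where
  "dist0 C = (INF y\<in>C. ereal (norm y))"

definition KL_property_at :: "('a::real_inner \<Rightarrow> ereal) \<Rightarrow> 'a \<Rightarrow> bool" where
  "KL_property_at h x0 \<longleftrightarrow>
     (\<exists>\<nu>>0. \<exists>V. \<exists>\<psi>\<in>KL_desingularizing \<nu>. open V \<and> x0 \<in> V \<and>
        (\<forall>x\<in>V. h x0 < h x \<and> h x < h x0 + \<nu> \<longrightarrow>
           ereal (deriv \<psi> (real_of_ereal (h x - h x0))) * dist0 (limiting_subdiff h x) \<ge> 1))"

definition KL_function :: "('a::real_inner \<Rightarrow> ereal) \<Rightarrow> bool" where
  "KL_function h \<longleftrightarrow> proper_fun h \<and> closed_fun h \<and>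
     (\<forall>x. limiting_subdiff h x \<noteq> {} \<longrightarrow> KL_property_at h x)"

section \<open>The difference-of-convex problem and its stationary points\<close>

definition objective ::
    "'a set \<Rightarrow> ('a \<Rightarrow> ereal) \<Rightarrow> ('a \<Rightarrow> real) \<Rightarrow> ('a \<Rightarrow> ereal) \<Rightarrow> 'a \<Rightarrow> ereal" where
  "objective Q P1 P2 f x = indicator_fun Q x + P1 x - ereal (P2 x) + f x"

definition H_fun :: "real \<Rightarrow> 'a::real_inner set \<Rightarrow> ('a \<Rightarrow> ereal) \<Rightarrow> ('a \<Rightarrow> real) \<Rightarrow> ('a \<Rightarrow> ereal)
    \<Rightarrow> 'a \<times> 'a \<Rightarrow> ereal" where
  "H_fun \<tau> Q P1 P2 f = (\<lambda>(u, v). objective Q P1 P2 f u + ereal (\<tau> / 2 * (norm (u - v))\<^sup>2))"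

text \<open>The sum of the indicator function and \<open>P1\<close> is convex, so its limiting subdifferential is the
  convex one.\<close>

definition stationary ::
    "'a::euclidean_space set \<Rightarrow> ('a \<Rightarrow> ereal) \<Rightarrow> ('a \<Rightarrow> real) \<Rightarrow> ('a \<Rightarrow> ereal) \<Rightarrow> 'a \<Rightarrow> bool" where
  "stationary Q P1 P2 f x \<longleftrightarrow>
     (\<exists>\<eta> \<in> convex_subdiff (\<lambda>y. indicator_fun Q y + P1 y) x.
      \<exists>\<xi> \<in> convex_subdiff (\<lambda>y. ereal (P2 y)) x. 0 = \<eta> - \<xi> + grad f x)"

definition l_stationary ::
    "'a::euclidean_space set \<Rightarrow> ('a \<Rightarrow> ereal) \<Rightarrow> ('a \<Rightarrow> real) \<Rightarrow> ('a \<Rightarrow> ereal) \<Rightarrow> 'a \<Rightarrow> bool" where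
  "l_stationary Q P1 P2 f x \<longleftrightarrow>
     (\<exists>U. open U \<and> x \<in> U \<and> cont_diff_on (\<lambda>y. ereal (P2 y)) U) \<and>
     (\<exists>\<eta> \<in> convex_subdiff (\<lambda>y. indicator_fun Q y + P1 y) x.
        0 = \<eta> - grad (\<lambda>y. ereal (P2 y)) x + grad f x)"

section \<open>The inexact Bregman proximal difference-of-convex algorithm\<close>

definition subproblem_obj :: "('a::euclidean_space \<Rightarrow> ereal) \<Rightarrow> ('a \<Rightarrow> ereal) \<Rightarrow> ('a \<Rightarrow> ereal)
    \<Rightarrow> 'a \<Rightarrow> 'a \<Rightarrow> real \<Rightarrow> 'a \<Rightarrow> ereal" where
  "subproblem_obj f P1 \<phi> xk \<xi>k \<gamma>k x =
     P1 x + ereal ((grad f xk - \<xi>k) \<bullet> (x - xk)) + ereal \<gamma>k * bregman \<phi> x xk"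

definition subproblem_solvable :: "('a::euclidean_space \<Rightarrow> ereal) \<Rightarrow> ('a \<Rightarrow> ereal) \<Rightarrow> ('a \<Rightarrow> ereal)
    \<Rightarrow> 'a \<Rightarrow> 'a \<Rightarrow> real \<Rightarrow> bool" where
  "subproblem_solvable f P1 \<phi> xk \<xi>k \<gamma>k \<longleftrightarrow>
     (let S = {x. is_arg_min (subproblem_obj f P1 \<phi> xk \<xi>k \<gamma>k) (\<lambda>_. True) x}
      in S \<noteq> {} \<and> S \<subseteq> interior (edom \<phi>))"

text \<open>\<open>previous xm1 x k\<close> is the iterate with index \<open>k - 1\<close>, where \<open>xm1\<close> has index \<open>-1\<close>.\<close>

definition previous :: "'a \<Rightarrow> (nat \<Rightarrow> 'a) \<Rightarrow> nat \<Rightarrow> 'a" where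
  "previous xm1 x k = (case k of 0 \<Rightarrow> xm1 | Suc j \<Rightarrow> x j)"

definition iBPDCA_SC2 :: "('a::euclidean_space \<Rightarrow> ereal) \<Rightarrow> ('a \<Rightarrow> ereal) \<Rightarrow> ('a \<Rightarrow> real)
    \<Rightarrow> ('a \<Rightarrow> ereal) \<Rightarrow> real \<Rightarrow> (nat \<Rightarrow> real) \<Rightarrow> 'a \<Rightarrow> 'a \<Rightarrow> (nat \<Rightarrow> 'a) \<Rightarrow> (nat \<Rightarrow> 'a)
    \<Rightarrow> (nat \<Rightarrow> 'a) \<Rightarrow> (nat \<Rightarrow> real) \<Rightarrow> bool" where
  "iBPDCA_SC2 f P1 P2 \<phi> \<sigma> \<gamma> x0 xm1 x \<xi> \<Delta> \<delta> \<longleftrightarrow>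
     x0 \<in> edom P1 \<inter> interior (edom \<phi>) \<and> xm1 \<in> interior (edom \<phi>) \<and> x 0 = x0 \<and>
     (\<forall>k. \<xi> k \<in> convex_subdiff (\<lambda>y. ereal (P2 y)) (x k) \<and>
          x (Suc k) \<in> edom P1 \<inter> interior (edom \<phi>) \<and>
          \<delta> k \<ge> 0 \<and>
          (\<exists>\<eta> \<in> eps_subdiff (\<delta> k) P1 (x (Suc k)).
             \<Delta> k = \<eta> + grad f (x k) - \<xi> k + \<gamma> k *\<^sub>R (grad \<phi> (x (Suc k)) - grad \<phi> (x k))) \<and>
          ereal ((norm (\<Delta> k))\<^sup>2 + \<bar>\<Delta> k \<bullet> (x (Suc k) - x k)\<bar> + \<delta> k)
            \<le> ereal (\<sigma> * \<gamma> k) * bregman \<phi> (x k) (previous xm1 x k))"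

end

theory Submission
  imports Defs
begin

text \<open>Put \<open>\<tau> = (\<gamma>min - L) \<mu> / 2\<close>. Adding the inexact optimality condition, the convexity of
  \<open>P2\<close> and the relative smoothness of \<open>f\<close> gives
  \<open>F (x (k+1)) + (\<gamma>min - L) D\<^sub>\<phi> (x (k+1), x k) \<le> F (x k) + \<sigma> \<gamma>max D\<^sub>\<phi> (x k, x (k-1))\<close>, where \<open>D\<^sub>\<phi>\<close> is
  the Bregman distance. This keeps the iterates in a sublevel set of \<open>F\<close> that does not depend on
  \<open>\<sigma>\<close>; there \<open>D\<^sub>\<phi>\<close> is comparable to the squared norm, so for small \<open>\<sigma>\<close> the merit function
  \<open>H\<^sub>\<tau> (x (k+1), x k)\<close> decreases by a multiple of the squared step length. Cluster points are
  stationary, hence \<open>P2\<close> has a locally Lipschitz gradient near each of them, and iterates close to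
  one carry a subgradient of \<open>H\<^sub>\<tau>\<close> bounded by the step length plus the norm of \<open>\<Delta>\<close>. The KL
  inequality at a single cluster point then traps the sequence near it and makes its total length
  finite; no uniform KL inequality over the set of cluster points is needed.\<close>

section \<open>Gradients and subgradients\<close>

lemma gderiv_unique:
  assumes "GDERIV h x :> a" "GDERIV h x :> b"
  shows "a = b"
proof -
  have "(\<lambda>z. z \<bullet> a) = (\<lambda>z. z \<bullet> b)"
    using assms has_derivative_unique unfolding gderiv_def by blast
  then have "a \<bullet> z = b \<bullet> z" for z by (metis inner_commute)
  then show ?thesis using vector_eq_rdot by blast
qed

lemma grad_eqI: "GDERIV (\<lambda>y. real_of_ereal (h y)) x :> g \<Longrightarrow> grad h x = g"
  unfolding grad_def using gderiv_unique by blast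

lemma gderiv_grad: "diff_at h x \<Longrightarrow> GDERIV (\<lambda>y. real_of_ereal (h y)) x :> grad h x"
  unfolding diff_at_def using grad_eqI by blast

lemma proper_fun_finite: "proper_fun h \<Longrightarrow> x \<in> edom h \<Longrightarrow> h x = ereal (real_of_ereal (h x))"
  unfolding proper_fun_def edom_def by (cases "h x") auto

lemma bregman_ereal:
  assumes "proper_fun \<phi>" "x \<in> edom \<phi>" "y \<in> edom \<phi>"
  shows "bregman \<phi> x y =
    ereal (real_of_ereal (\<phi> x) - real_of_ereal (\<phi> y) - grad \<phi> y \<bullet> (x - y))"
proof -
  obtain a b where "\<phi> x = ereal a" "\<phi> y = ereal b"
    using proper_fun_finite[OF assms(1,2)] proper_fun_finite[OF assms(1,3)] by metis
  then show ?thesis by (simp add: bregman_def)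
qed

text \<open>Strong convexity on the segment, divided by \<open>t\<close>, bounds the difference
  quotient of \<open>h\<close> at \<open>y\<close> in direction \<open>x - y\<close>; letting
  \<open>t\<close> tend to 0 from the right produces the gradient.\<close>

lemma strongly_convex_on_gradient_ineq:
  fixes h :: "'a::real_inner \<Rightarrow> ereal"
  assumes sc: "strongly_convex_on \<mu> N h" and seg: "closed_segment x y \<subseteq> N"
    and pr: "proper_fun h" and dom: "N \<subseteq> edom h" and d: "diff_at h y"
  shows "real_of_ereal (h y) + grad h y \<bullet> (x - y) + \<mu> / 2 * (norm (x - y))\<^sup>2
    \<le> real_of_ereal (h x)"
proof -
  let ?h = "\<lambda>z. real_of_ereal (h z)"
  define q where "q t = ?h (y + t *\<^sub>R (x - y))" for t
  have fin: "h z = ereal (?h z)" if "z \<in> closed_segment x y" for z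
    using that seg dom by (intro proper_fun_finite[OF pr]) auto
  have "((\<lambda>t. y + t *\<^sub>R (x - y)) has_derivative (\<lambda>t. t *\<^sub>R (x - y))) (at 0)"
    by (auto intro!: derivative_eq_intros)
  moreover have "(?h has_derivative (\<lambda>z. grad h y \<bullet> z)) (at (y + 0 *\<^sub>R (x - y)))"
    using gderiv_grad[OF d] by (simp add: gderiv_def inner_commute)
  ultimately have "((\<lambda>t. ?h (y + t *\<^sub>R (x - y))) has_derivative
      (\<lambda>t. grad h y \<bullet> (t *\<^sub>R (x - y)))) (at 0)"
    by (rule has_derivative_compose)
  then have "(q has_real_derivative (grad h y \<bullet> (x - y))) (at 0)"
    unfolding q_def has_field_derivative_def by (simp add: mult_commute_abs)
  then have lim: "((\<lambda>t. (q t - q 0) / t) \<longlongrightarrow> grad h y \<bullet> (x - y)) (at_right 0)"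
    unfolding has_field_derivative_iff by (simp add: filterlim_at_split)
  have lim2: "((\<lambda>t. ?h x - ?h y - \<mu> / 2 * (1 - t) * (norm (x - y))\<^sup>2)
      \<longlongrightarrow> ?h x - ?h y - \<mu> / 2 * (1 - 0) * (norm (x - y))\<^sup>2) (at_right 0)"
    by (intro tendsto_intros)
  have "\<forall>\<^sub>F t in at_right (0::real). 0 < t \<and> t < 1"
    using eventually_at_right_real[of 0 1] by (simp add: eventually_mono)
  then have "\<forall>\<^sub>F t in at_right 0.
      (q t - q 0) / t \<le> ?h x - ?h y - \<mu> / 2 * (1 - t) * (norm (x - y))\<^sup>2"
  proof (rule eventually_mono)
    fix t :: real assume t: "0 < t \<and> t < 1"
    have eq: "t *\<^sub>R x + (1 - t) *\<^sub>R y = y + t *\<^sub>R (x - y)" by (simp add: algebra_simps)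
    have "y + t *\<^sub>R (x - y) \<in> closed_segment y x"
      unfolding closed_segment_image_interval using t
      by (auto intro!: image_eqI[where x=t] simp: algebra_simps)
    then have inseg: "y + t *\<^sub>R (x - y) \<in> closed_segment x y"
      by (simp add: closed_segment_commute)
    have "h (t *\<^sub>R x + (1 - t) *\<^sub>R y)
          \<le> ereal t * h x + ereal (1 - t) * h y - ereal (\<mu> / 2 * t * (1 - t) * (norm (x - y))\<^sup>2)"
      using sc seg t unfolding strongly_convex_on_def by simp
    moreover obtain a b c where "h x = ereal a" "h y = ereal b" "h (y + t *\<^sub>R (x - y)) = ereal c"
      using fin[OF inseg] fin[OF ends_in_segment(1)] fin[OF ends_in_segment(2)] by metis
    ultimately have "q t \<le> t * ?h x + (1 - t) * ?h y
        - \<mu> / 2 * t * (1 - t) * (norm (x - y))\<^sup>2"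
      unfolding eq q_def by simp
    then have "q t - q 0 \<le> t * (?h x - ?h y - \<mu> / 2 * (1 - t) * (norm (x - y))\<^sup>2)"
      by (simp add: q_def algebra_simps)
    then show "(q t - q 0) / t \<le> ?h x - ?h y - \<mu> / 2 * (1 - t) * (norm (x - y))\<^sup>2"
      using t by (simp add: divide_simps mult.commute)
  qed
  from tendsto_le[OF _ lim2 lim this] show ?thesis by simp
qed

section \<open>Subgradients: boundedness, differentiable points, smooth perturbations\<close>

lemma subgradient_norm_bound:
  fixes h :: "'a::real_inner \<Rightarrow> real"
  assumes "\<xi> \<in> convex_subdiff (\<lambda>y. ereal (h y)) x" "\<And>y. norm (y - x) \<le> 1 \<Longrightarrow> \<bar>h y\<bar> \<le> B"
  shows "norm \<xi> \<le> 2 * B"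
proof (cases "\<xi> = 0")
  case True
  then show ?thesis using assms(2)[of x] by simp
next
  case False
  \<comment> \<open>The test point lies at unit distance from \<open>x\<close> in the direction of
    \<open>\<xi>\<close>, where the linear term equals the norm of \<open>\<xi>\<close>.\<close>
  have "h (x + sgn \<xi>) \<ge> h x + \<xi> \<bullet> sgn \<xi>"
    using assms(1) unfolding eps_subdiff_def by (auto dest!: spec[of _ "x + sgn \<xi>"])
  moreover have "\<xi> \<bullet> sgn \<xi> = norm \<xi>"
    using False by (simp add: sgn_div_norm dot_square_norm power2_eq_square)
  moreover have "\<bar>h (x + sgn \<xi>)\<bar> \<le> B" "\<bar>h x\<bar> \<le> B"
    using assms(2)[of x] assms(2)[of "x + sgn \<xi>"] False by (auto simp: norm_sgn)
  ultimately show ?thesis by linarith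
qed

text \<open>Subtracting the linear function of a subgradient leaves a global minimum at
  \<open>x\<close>, where the derivative vanishes.\<close>

lemma subgradient_eq_gradient:
  fixes h :: "'a::real_inner \<Rightarrow> real"
  assumes "\<xi> \<in> convex_subdiff (\<lambda>y. ereal (h y)) x" "GDERIV h x :> g"
  shows "\<xi> = g"
proof -
  have "((\<lambda>y. h y - \<xi> \<bullet> y) has_derivative (\<lambda>z. g \<bullet> z - \<xi> \<bullet> z)) (at x)"
    using assms(2) unfolding gderiv_def
    by (auto intro!: derivative_eq_intros simp: inner_commute)
  moreover have "\<forall>y\<in>UNIV. h x - \<xi> \<bullet> x \<le> h y - \<xi> \<bullet> y"
    using assms(1) unfolding eps_subdiff_def by (auto simp: inner_diff_right algebra_simps)
  ultimately have "(\<lambda>z. g \<bullet> z - \<xi> \<bullet> z) = (\<lambda>z. 0)"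
    by (intro differential_zero_maxmin[of x UNIV]) auto
  then have "\<xi> \<bullet> z = g \<bullet> z" for z by (metis eq_iff_diff_eq_0)
  then show ?thesis using vector_eq_rdot by blast
qed

text \<open>The convex part contributes a nonnegative quotient, the differentiable part one that
  tends to 0. Agreement with the sum is asked only near \<open>x\<close>, so \<open>g\<close> may
  come from a function that is finite only locally.\<close>

lemma frechet_subdiff_add_smooth:
  fixes p h :: "'a::real_inner \<Rightarrow> ereal"
  assumes sub: "\<eta> \<in> convex_subdiff p x" and fin: "p x = ereal c"
    and g: "GDERIV g x :> d" and h: "\<forall>\<^sub>F y in nhds x. h y = p y + ereal (g y)"
  shows "\<eta> + d \<in> frechet_subdiff h x"
proof -
  have hx: "h x = ereal (c + g x)" using eventually_nhds_x_imp_x[OF h] fin by simp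
  have key: "\<forall>\<^sub>F y in at x. r < (h y - h x - ereal ((\<eta> + d) \<bullet> (y - x))) / ereal (norm (y - x))"
    if r: "r < 0" for r
  proof -
    \<comment> \<open>Since \<open>r\<close> may be minus infinity, a real \<open>s\<close> between
      \<open>r\<close> and 0 serves as the tolerance.\<close>
    obtain s where "r < ereal s" "ereal s < 0" using ereal_dense2[OF r] by auto
    then have s: "s < 0" "r \<le> ereal s" by auto
    have "((\<lambda>y. norm (g y - g x - d \<bullet> (y - x)) / norm (y - x)) \<longlongrightarrow> 0) (at x)"
      using g unfolding gderiv_def has_derivative_iff_norm by (simp add: inner_commute)
    then have "\<forall>\<^sub>F y in at x. norm (g y - g x - d \<bullet> (y - x)) / norm (y - x) < - s"
      using s by (intro order_tendstoD) auto
    moreover have "\<forall>\<^sub>F y in at x. h y = p y + ereal (g y)"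
      using h by (simp add: eventually_nhds_conv_at)
    moreover have "\<forall>\<^sub>F y in at x. y \<noteq> x" by (simp add: eventually_at_filter)
    ultimately show ?thesis
    proof eventually_elim
      case (elim y)
      have pos: "0 < norm (y - x)" using elim by simp
      have py: "p y \<ge> ereal (c + \<eta> \<bullet> (y - x))"
        using sub fin unfolding eps_subdiff_def by auto
      show ?case
      proof (cases "p y")
        case (real b)
        have "\<eta> \<bullet> (y - x) \<le> b - c" using py real by simp
        moreover have "s * norm (y - x) < g y - g x - d \<bullet> (y - x)"
          using elim pos by (simp add: divide_simps split: if_splits)
        ultimately have "s * norm (y - x) < b + g y - (c + g x) - (\<eta> + d) \<bullet> (y - x)"
          by (simp add: inner_add_left)
        then have "s < (b + g y - (c + g x) - (\<eta> + d) \<bullet> (y - x)) / norm (y - x)"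
          using pos by (simp add: divide_simps)
        then have "ereal s < (h y - h x - ereal ((\<eta> + d) \<bullet> (y - x))) / ereal (norm (y - x))"
          using elim pos hx real by simp
        then show ?thesis using s(2) by (rule order.strict_trans1[rotated])
      next
        case PInf
        then show ?thesis using elim hx pos r by (auto simp: order.strict_trans[of r 0 \<infinity>])
      next
        case MInf
        then show ?thesis using py by simp
      qed
    qed
  qed
  have "x \<in> edom h" using hx by (simp add: edom_def)
  moreover have "Liminf (at x) (\<lambda>y. (h y - h x - ereal ((\<eta> + d) \<bullet> (y - x))) / ereal (norm (y - x))) \<ge> 0"
    using key unfolding le_Liminf_iff by blast
  ultimately show ?thesis unfolding frechet_subdiff_def by simp
qed

lemma frechet_subset_limiting_subdiff: "frechet_subdiff h x \<subseteq> limiting_subdiff h x"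
proof
  fix d assume d: "d \<in> frechet_subdiff h x"
  then have "x \<in> edom h" by (simp add: frechet_subdiff_def)
  with d show "d \<in> limiting_subdiff h x"
    unfolding limiting_subdiff_def
    by (intro CollectI conjI exI[of _ "\<lambda>_. x"] exI[of _ "\<lambda>_. d"]) auto
qed

section \<open>Convergence from the KL inequality\<close>

text \<open>The factor 1/2 lets the total length absorb itself: while the points stay in the ball,
  the length is at most \<open>2 * dist (u 1) (u 0) + suminf e + 2 * p 0\<close>, and by
  \<open>start\<close> a path of that length cannot leave the ball.\<close>

lemma trapped_near_point:
  fixes u :: "nat \<Rightarrow> 'a::metric_space" and e p :: "nat \<Rightarrow> real"
  assumes step: "\<And>k. \<lbrakk>u k \<in> ball a \<rho>; u (Suc k) \<in> ball a \<rho>\<rbrakk> \<Longrightarrow>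
      dist (u (k + 2)) (u (k + 1)) \<le> (dist (u (k + 1)) (u k) + e k) / 2 + p k - p (Suc k)"
    and p: "\<And>k. 0 \<le> p k" and e: "\<And>k. 0 \<le> e k" "summable e"
    and start: "dist (u 0) a + 2 * dist (u 1) (u 0) + suminf e + 2 * p 0 < \<rho>"
  shows "summable (\<lambda>k. dist (u (Suc k)) (u k))"
proof -
  define d where "d k = dist (u (Suc k)) (u k)" for k
  \<comment> \<open>\<open>Q k\<close> is the sum of the first \<open>k\<close> step inequalities
    with \<open>p\<close> telescoped. It serves as induction hypothesis because it already confines
    \<open>u k\<close> and \<open>u (Suc k)\<close> to the ball.\<close>
  define Q where "Q k \<longleftrightarrow> (\<Sum>j<k. d (Suc j)) \<le> ((\<Sum>j<k. d j) + (\<Sum>j<k. e j)) / 2 + p 0 - p k" for k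
  have d0: "0 \<le> d k" for k by (simp add: d_def)
  have esum: "(\<Sum>j<k. e j) \<le> suminf e" for k using e by (intro sum_le_suminf) auto
  have bound: "(\<Sum>j<Suc k. d j) \<le> 2 * d 0 + suminf e + 2 * p 0" if "Q k" for k
  proof -
    have "(\<Sum>j<Suc k. d j) = d 0 + (\<Sum>j<k. d (Suc j))" by (rule sum.lessThan_Suc_shift)
    moreover have "(\<Sum>j<k. d j) \<le> (\<Sum>j<Suc k. d j)" using d0 by simp
    \<comment> \<open>With S the sum of \<open>d\<close> below \<open>Suc k\<close>, this is S \<le>
      \<open>d 0\<close> + (S + \<open>suminf e\<close>) / 2 + \<open>p 0\<close>, solved for
      S.\<close>
    ultimately show ?thesis using that esum[of k] p[of k] unfolding Q_def by argo
  qed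
  have walk: "dist (u k) a \<le> dist (u 0) a + (\<Sum>j<k. d j)" for k
  proof (induction k)
    case (Suc k)
    have "dist (u (Suc k)) a \<le> d k + dist (u k) a" unfolding d_def by (rule dist_triangle)
    with Suc show ?case by simp
  qed simp
  have near: "u k \<in> ball a \<rho> \<and> u (Suc k) \<in> ball a \<rho>" if "Q k" for k
  proof -
    have "dist (u k) a < \<rho>" "dist (u (Suc k)) a < \<rho>"
      using walk[of k] walk[of "Suc k"] bound[OF that] start d0[of k] d_def[of 0] by auto
    then show ?thesis by (simp add: dist_commute)
  qed
  have Q: "Q k" for k
  proof (induction k)
    case (Suc k)
    have "d (Suc k) \<le> (d k + e k) / 2 + p k - p (Suc k)"
      using step near[OF Suc] by (simp add: d_def)
    with Suc show ?case unfolding Q_def by (simp add: field_simps)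
  qed (simp add: Q_def)
  have "(\<Sum>j<k. d j) \<le> 2 * d 0 + suminf e + 2 * p 0" for k
    using bound[OF Q[of k]] d0[of k] by simp
  then have "summable d" using d0 by (intro summableI_nonneg_bounded)
  then show ?thesis unfolding d_def[abs_def] .
qed

lemma summable_dist_imp_convergent:
  fixes u :: "nat \<Rightarrow> 'a::banach"
  assumes "summable (\<lambda>k. dist (u (Suc k)) (u k))"
  shows "convergent u"
proof -
  have s: "summable (\<lambda>k. u (Suc k) - u k)"
    by (rule summable_norm_cancel) (use assms in \<open>simp add: dist_norm\<close>)
  have "convergent (\<lambda>n. \<Sum>k<n. u (Suc k) - u k)" 
    using s unfolding summable_iff_convergent .
  then have "convergent (\<lambda>n. u n - u 0)" 
    unfolding sum_lessThan_telescope .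
  then have "convergent (\<lambda>n. (u n - u 0) + u 0)" 
    by (rule convergent_add[OF _ convergent_const])
  then show ?thesis by simp
qed

section \<open>Descent sequences and desingularizing functions\<close>

lemma steps_tendsto_0_of_descent:
  fixes x :: "nat \<Rightarrow> 'a::metric_space" and h :: "nat \<Rightarrow> real"
  assumes lim: "h \<longlonglongrightarrow> \<zeta>" and c: "0 < c"
    and desc: "\<And>k. h (Suc k) + c * (dist (x (k + 2)) (x (k + 1)))\<^sup>2 \<le> h k"
  shows "(\<lambda>k. dist (x (Suc k)) (x k)) \<longlonglongrightarrow> 0"
proof -
  \<comment> \<open>The squared steps are dominated by the decrements of the convergent sequence
    \<open>h\<close>.\<close>
  have "(\<lambda>k. (h k - h (Suc k)) / c) \<longlonglongrightarrow> (\<zeta> - \<zeta>) / c"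
    using lim c by (intro tendsto_intros) (auto simp: LIMSEQ_Suc)
  then have "(\<lambda>k. (h k - h (Suc k)) / c) \<longlonglongrightarrow> 0" by simp
  moreover have "\<forall>\<^sub>F k in sequentially.
      norm ((dist (x (k + 2)) (x (k + 1)))\<^sup>2) \<le> (h k - h (Suc k)) / c"
  proof (intro always_eventually allI)
    fix k show "norm ((dist (x (k + 2)) (x (k + 1)))\<^sup>2) \<le> (h k - h (Suc k)) / c"
      using desc[of k] c by (simp add: field_simps)
  qed
  ultimately have "(\<lambda>k. (dist (x (k + 2)) (x (k + 1)))\<^sup>2) \<longlonglongrightarrow> 0"
    by (rule Lim_null_comparison[rotated])
  then have "(\<lambda>k. sqrt ((dist (x (k + 2)) (x (k + 1)))\<^sup>2)) \<longlonglongrightarrow> sqrt 0"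
    by (rule tendsto_real_sqrt)
  then have "(\<lambda>k. dist (x (Suc (Suc k))) (x (Suc k))) \<longlonglongrightarrow> 0" by simp
  then show ?thesis by (rule LIMSEQ_imp_Suc)
qed

text \<open>A concave function lies below its tangent at the interior point \<open>t\<close>; the
  other point \<open>s\<close> may be the endpoint 0, where \<open>\<psi>\<close> need not be
  differentiable.\<close>

lemma KL_desingularizing_tangent:
  assumes \<psi>: "\<psi> \<in> KL_desingularizing \<nu>" and s: "0 \<le> s" "ereal s < \<nu>" and t: "0 < t" "ereal t < \<nu>"
  shows "deriv \<psi> t * (t - s) \<le> \<psi> t - \<psi> s"
proof -
  let ?I = "KL_interval \<nu>"
  have cv: "convex_on ?I (\<lambda>r. - \<psi> r)" and df: "\<psi> differentiable (at t)"
    using \<psi> t unfolding KL_desingularizing_def concave_on_def KL_interval_def by auto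
  \<comment> \<open>A real \<open>b\<close> above \<open>t\<close> yields an open interval around
    \<open>t\<close> even when \<open>\<nu>\<close> is infinite.\<close>
  obtain b where b: "ereal t < ereal b" "ereal b < \<nu>" using ereal_dense2[OF t(2)] by auto
  have "{0<..<b} \<subseteq> ?I"
  proof
    fix r assume "r \<in> {0<..<b}"
    then have "ereal r < ereal b" "0 \<le> r" by auto
    then show "r \<in> ?I" using b(2) order.strict_trans[of "ereal r" "ereal b" \<nu>]
      unfolding KL_interval_def by auto
  qed
  then have "t \<in> interior ?I" using t b by (intro interiorI[of "{0<..<b}"]) auto
  moreover have "DERIV \<psi> t :> deriv \<psi> t"
    using df by (simp add: DERIV_deriv_iff_real_differentiable)
  then have "((\<lambda>r. - \<psi> r) has_field_derivative - deriv \<psi> t) (at t within ?I)"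
    by (rule DERIV_minus[OF has_field_derivative_at_within])
  moreover have "s \<in> ?I" using s by (simp add: KL_interval_def)
  ultimately have "- \<psi> s - (- \<psi> t) \<ge> - deriv \<psi> t * (s - t)"
    using cv convex_on_imp_convex[OF cv]
    by (intro convex_on_imp_above_tangent[where A="?I"]) (auto intro: convex_connected)
  then show ?thesis by (simp add: algebra_simps)
qed

text \<open>If \<open>h\<close> reaches its limit, all later steps vanish. Otherwise the KL
  inequality at \<open>(a, a)\<close> and the tangent bound turn the decrease of \<open>h\<close>
  into the step inequality of \<open>trapped_near_point\<close>, started at a late iterate close to
  \<open>a\<close>. Subgradient bounds are required only near \<open>a\<close>, since the iterates
  are trapped there.\<close>

lemma KL_convergence:
  fixes x :: "nat \<Rightarrow> 'a::euclidean_space" and H :: "'a \<times> 'a \<Rightarrow> ereal" and h e :: "nat \<Rightarrow> real"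
  assumes KL: "KL_property_at H (a, a)"
    and Hh: "\<And>k. H (x (Suc k), x k) = ereal (h k)"
    and Ha: "H (a, a) = ereal \<zeta>" and lim: "h \<longlonglongrightarrow> \<zeta>"
    and c: "0 < c" and desc: "\<And>k. h (Suc k) + c * (dist (x (k + 2)) (x (k + 1)))\<^sup>2 \<le> h k"
    and cluster: "strict_mono r" "(x \<circ> r) \<longlonglongrightarrow> a"
    and C: "0 < C" and \<rho>1: "0 < \<rho>1"
    and sub: "\<forall>\<^sub>F k in sequentially. x k \<in> ball a \<rho>1 \<longrightarrow> x (Suc k) \<in> ball a \<rho>1 \<longrightarrow>
      (\<exists>w\<in>limiting_subdiff H (x (Suc k), x k). norm w \<le> C * (dist (x (Suc k)) (x k) + e k))"
    and e: "\<And>k. 0 \<le> e k" "summable e"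
  shows "x \<longlonglongrightarrow> a"
proof -
  have conv: "x \<longlonglongrightarrow> a" if c: "convergent x"
  proof -
    obtain l where l: "x \<longlonglongrightarrow> l" using c by (auto simp: convergent_def)
    then have "(x \<circ> r) \<longlonglongrightarrow> l" using cluster(1) by (rule LIMSEQ_subseq_LIMSEQ)
    then have "l = a" using cluster(2) LIMSEQ_unique by blast
    with l show ?thesis by simp
  qed
  have dec: "decseq h"
  proof (rule decseq_SucI)
    fix n have "0 \<le> c * (dist (x (n + 2)) (x (n + 1)))\<^sup>2" using c by simp
    then show "h (Suc n) \<le> h n" using desc[of n] by linarith
  qed
  have ge: "\<zeta> \<le> h k" for k using dec lim by (rule decseq_ge)
  show ?thesis
  proof (cases "\<exists>k. h k = \<zeta>")
    case True
    then obtain k0 where k0: "h k0 = \<zeta>" by blast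
    have hk: "h k = \<zeta>" if "k \<ge> k0" for k
      using ge[of k] decseqD[OF dec that] k0 by simp
    have "x (k + 2) = x (k + 1)" if "k \<ge> k0" for k
    proof -
      have "c * (dist (x (k + 2)) (x (k + 1)))\<^sup>2 \<le> 0" using desc[of k] hk that by simp
      then show ?thesis using c by (simp add: mult_le_0_iff)
    qed
    then have "dist (x (Suc (k + (k0 + 1)))) (x (k + (k0 + 1))) = 0" for k
      by (simp add: add.commute)
    then have "summable (\<lambda>k. dist (x (Suc (k + (k0 + 1)))) (x (k + (k0 + 1))))" by simp
    then have "summable (\<lambda>k. dist (x (Suc k)) (x k))"
      by (subst (asm) summable_iff_shift[of "\<lambda>k. dist (x (Suc k)) (x k)"])
    then show ?thesis by (intro conv summable_dist_imp_convergent)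
  next
    case False
    then have gt: "\<zeta> < h k" for k using ge[of k] by (metis order_less_le)
    from KL obtain \<nu> V \<psi> where \<nu>: "\<nu> > 0" and V: "open V" "(a, a) \<in> V" and \<psi>: "\<psi> \<in> KL_desingularizing \<nu>"
      and KLV: "\<And>y. \<lbrakk>y \<in> V; H (a, a) < H y; H y < H (a, a) + \<nu>\<rbrakk> \<Longrightarrow>
        ereal (deriv \<psi> (real_of_ereal (H y - H (a, a)))) * dist0 (limiting_subdiff H y) \<ge> 1"
      unfolding KL_property_at_def by blast
    \<comment> \<open>The KL neighborhood lives in the product space; a ball about \<open>a\<close>
      inside both factors catches pairs of consecutive iterates.\<close>
    obtain A B where AB: "open A" "open B" "a \<in> A" "a \<in> B" "A \<times> B \<subseteq> V"
      using V(2) by (auto elim: open_prod_elim[OF V(1)])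
    then obtain \<rho>2 where \<rho>2: "\<rho>2 > 0" "ball a \<rho>2 \<subseteq> A \<inter> B"
      using open_contains_ball_eq[of "A \<inter> B" a] by (auto simp: open_Int)
    define \<rho> where "\<rho> = min \<rho>1 \<rho>2"
    have \<rho>: "\<rho> > 0" using \<rho>1 \<rho>2 by (simp add: \<rho>_def)
    \<comment> \<open>The factor \<open>C / (2 * c)\<close> is chosen so that the bound on the
      squared step below becomes \<open>A * (2 * (p k - p (Suc k)))\<close>.\<close>
    define p where "p k = C / (2 * c) * \<psi> (h k - \<zeta>)" for k
    obtain b where b: "0 < ereal b" "ereal b < \<nu>" using ereal_dense2[OF \<nu>] by blast
    have lim0: "(\<lambda>k. h k - \<zeta>) \<longlonglongrightarrow> 0" using lim by (simp add: LIM_zero)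
    then have "\<forall>\<^sub>F k in sequentially. h k - \<zeta> < b" using b by (intro order_tendstoD) auto
    then have evb: "\<forall>\<^sub>F k in sequentially. ereal (h k - \<zeta>) < \<nu>"
    proof (rule eventually_mono)
      fix k assume "h k - \<zeta> < b"
      then have "ereal (h k - \<zeta>) < ereal b" by simp
      then show "ereal (h k - \<zeta>) < \<nu>" using b(2) by (rule order.strict_trans)
    qed
    have inI: "h k - \<zeta> \<in> KL_interval \<nu>" if "ereal (h k - \<zeta>) < \<nu>" for k
      using that ge[of k] by (simp add: KL_interval_def)
    have "continuous (at 0 within KL_interval \<nu>) \<psi>" "\<psi> 0 = 0"
      using \<psi> by (auto simp: KL_desingularizing_def)
    then have "(\<lambda>k. \<psi> (h k - \<zeta>)) \<longlonglongrightarrow> 0"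
      using continuous_within_tendsto_compose[of 0 "KL_interval \<nu>" \<psi> "\<lambda>k. h k - \<zeta>" sequentially]
        lim0 eventually_mono[OF evb inI] by auto
    then have plim: "p \<longlonglongrightarrow> 0" unfolding p_def by (rule tendsto_mult_right_zero)
    have dlim: "(\<lambda>k. dist (x (Suc k)) (x k)) \<longlonglongrightarrow> 0"
      using lim c desc by (rule steps_tendsto_0_of_descent)
    have step: "dist (x (k + 2)) (x (k + 1)) \<le> (dist (x (k + 1)) (x k) + e k) / 2 + p k - p (Suc k)"
      if near: "x k \<in> ball a \<rho>" "x (Suc k) \<in> ball a \<rho>" and small: "ereal (h k - \<zeta>) < \<nu>"
        and w: "x k \<in> ball a \<rho>1 \<longrightarrow> x (Suc k) \<in> ball a \<rho>1 \<longrightarrow>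
      (\<exists>w\<in>limiting_subdiff H (x (Suc k), x k). norm w \<le> C * (dist (x (Suc k)) (x k) + e k))" for k
    proof -
      define A where "A = dist (x (k + 1)) (x k) + e k"
      define D where "D = dist (x (k + 2)) (x (k + 1))"
      define t where "t = h k - \<zeta>"
      define s where "s = h (Suc k) - \<zeta>"
      have ts: "0 < t" "0 < s" "s \<le> t" using gt decseqD[OF dec, of k "Suc k"] by (auto simp: t_def s_def)
      have s\<nu>: "ereal s < \<nu>" using ts(3) small unfolding t_def[symmetric]
        by (metis ereal_less_eq(3) order.strict_trans1)
      obtain w where wl: "w \<in> limiting_subdiff H (x (Suc k), x k)" "norm w \<le> C * A"
        using w near by (auto simp: \<rho>_def A_def)
      have "x (Suc k) \<in> ball a \<rho>2" "x k \<in> ball a \<rho>2" using near by (simp_all add: \<rho>_def)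
      then have "(x (Suc k), x k) \<in> V" using \<rho>2(2) AB(5) by blast
      moreover have "H (x (Suc k), x k) < H (a, a) + \<nu>"
        using \<nu> small unfolding Hh Ha by (cases \<nu>) (simp_all add: algebra_simps)
      ultimately have "1 \<le> ereal (deriv \<psi> t) * dist0 (limiting_subdiff H (x (Suc k), x k))"
        using KLV[of "(x (Suc k), x k)"] gt[of k] by (simp add: Hh Ha t_def)
      moreover have \<psi>pos: "0 < deriv \<psi> t"
        using \<psi> ts(1) inI[OF small] unfolding t_def[symmetric] by (auto simp: KL_desingularizing_def)
      moreover have "dist0 (limiting_subdiff H (x (Suc k), x k)) \<le> ereal (norm w)"
        unfolding dist0_def using wl(1) by (rule INF_lower)
      ultimately have "1 \<le> ereal (deriv \<psi> t) * ereal (norm w)"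
        by (meson ereal_less_eq(5) ereal_mult_left_mono less_imp_le order_trans)
      then have "1 \<le> deriv \<psi> t * norm w" by (simp add: one_ereal_def)
      also have "\<dots> \<le> deriv \<psi> t * (C * A)" using wl(2) \<psi>pos by simp
      finally have one: "1 \<le> deriv \<psi> t * (C * A)" .
      have A0: "0 \<le> A" using e(1) by (simp add: A_def)
      have "c * D\<^sup>2 \<le> t - s" using desc[of k] by (simp add: D_def t_def s_def)
      \<comment> \<open>The decrease is multiplied by a quantity that the KL inequality makes at
        least 1; concavity then trades the derivative for a difference of values of
        \<open>\<psi>\<close>.\<close>
      also have "\<dots> \<le> (t - s) * (deriv \<psi> t * (C * A))" using mult_left_mono[OF one, of "t - s"] ts(3) by simp
      also have "\<dots> = (deriv \<psi> t * (t - s)) * (C * A)" by simp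
      also have "\<dots> \<le> (\<psi> t - \<psi> s) * (C * A)"
        using KL_desingularizing_tangent[OF \<psi> _ s\<nu> ts(1)] ts small A0 C
        by (intro mult_right_mono) (auto simp: t_def)
      finally have "D\<^sup>2 \<le> A * (2 * (p k - p (Suc k)))"
        using c by (simp add: p_def t_def s_def field_simps)
      moreover have "0 \<le> \<psi> t - \<psi> s"
      proof -
        have "0 \<le> deriv \<psi> t * (t - s)" using \<psi>pos ts by simp
        also have "\<dots> \<le> \<psi> t - \<psi> s"
          using KL_desingularizing_tangent[OF \<psi> _ s\<nu> ts(1)] ts small by (auto simp: t_def)
        finally show ?thesis .
      qed
      then have p0: "0 \<le> p k - p (Suc k)" using C c 
        by (simp add: p_def t_def s_def right_diff_distrib[symmetric] del: times_divide_eq_left)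
      \<comment> \<open>Arithmetic-geometric mean inequality for \<open>A\<close> and
        \<open>2 * (p k - p (Suc k))\<close>.\<close>
      ultimately have "D\<^sup>2 \<le> ((A + 2 * (p k - p (Suc k))) / 2)\<^sup>2"
        using zero_le_power2[of "A - 2 * (p k - p (Suc k))"] by (simp add: power2_eq_square algebra_simps)
      then have "D \<le> (A + 2 * (p k - p (Suc k))) / 2" by (rule power2_le_imp_le) (use A0 p0 in simp)
      then show ?thesis by (simp add: A_def D_def field_simps)
    qed
    have p_nonneg: "0 \<le> p k" if "ereal (h k - \<zeta>) < \<nu>" for k
      using \<psi> inI[OF that] C c by (simp add: p_def KL_desingularizing_def)
    obtain N1 where N1: "\<And>k. k \<ge> N1 \<Longrightarrow> ereal (h k - \<zeta>) < \<nu>" "\<And>k. k \<ge> N1 \<Longrightarrow> x k \<in> ball a \<rho>1 \<longrightarrow> x (Suc k) \<in> ball a \<rho>1 \<longrightarrow>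
      (\<exists>w\<in>limiting_subdiff H (x (Suc k), x k). norm w \<le> C * (dist (x (Suc k)) (x k) + e k))"
      using eventually_conj[OF evb sub] unfolding eventually_sequentially by blast
    obtain N2 where N2: "\<And>k. k \<ge> N2 \<Longrightarrow> norm (\<Sum>i. e (i + k)) < \<rho> / 4"
      using suminf_exist_split[OF _ e(2), of "\<rho> / 4"] \<rho> by auto
    have "\<forall>\<^sub>F k in sequentially. dist (x (Suc k)) (x k) < \<rho> / 8" "\<forall>\<^sub>F k in sequentially. p k < \<rho> / 8"
      using dlim plim \<rho> by (auto intro!: order_tendstoD)
    then have "\<forall>\<^sub>F k in sequentially. dist (x (Suc k)) (x k) < \<rho> / 8 \<and> p k < \<rho> / 8"
      by (rule eventually_conj)
    then obtain N3 where N3: "\<And>k. k \<ge> N3 \<Longrightarrow> dist (x (Suc k)) (x k) < \<rho> / 8 \<and> p k < \<rho> / 8"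
      unfolding eventually_sequentially by blast
    obtain N4 where N4: "\<And>k. k \<ge> N4 \<Longrightarrow> dist (x (r k)) a < \<rho> / 4"
      using metric_LIMSEQ_D[OF cluster(2), of "\<rho> / 4"] \<rho> by auto
    \<comment> \<open>An index of the subsequence beyond all thresholds, so that \<open>x N\<close>
      is close to \<open>a\<close>. Each of the four terms in the start condition is then below
      \<open>\<rho> / 4\<close>, the step and \<open>p\<close> being counted twice.\<close>
    define N where "N = r (N1 + N2 + N3 + N4)"
    have "N1 + N2 + N3 + N4 \<le> N" unfolding N_def using cluster(1) by (rule seq_suble)
    then have N: "N \<ge> N1" "N \<ge> N2" "N \<ge> N3" by auto
    have "summable (\<lambda>k. dist (x (Suc k + N)) (x (k + N)))"
    proof (rule trapped_near_point[where a=a and \<rho>=\<rho> and e="\<lambda>k. e (k + N)" and p="\<lambda>k. p (k + N)"])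
      fix k assume "x (k + N) \<in> ball a \<rho>" "x (Suc k + N) \<in> ball a \<rho>"
      then show "dist (x (k + 2 + N)) (x (k + 1 + N)) \<le>
          (dist (x (k + 1 + N)) (x (k + N)) + e (k + N)) / 2 + p (k + N) - p (Suc k + N)"
        using step[of "k + N"] N1[of "k + N"] N(1) by (simp add: add.commute)
    next
      fix k show "0 \<le> p (k + N)" using p_nonneg N1 N(1) by simp
    next
      show "summable (\<lambda>k. e (k + N))" using e(2) by (simp add: summable_iff_shift)
    next
      have "dist (x N) a < \<rho> / 4" unfolding N_def using N4 by simp
      then show "dist (x (0 + N)) a + 2 * dist (x (1 + N)) (x (0 + N)) + (\<Sum>k. e (k + N)) + 2 * p (0 + N) < \<rho>"
          using N2[OF N(2)] N3[THEN conjunct1, OF N(3)] N3[THEN conjunct2, OF N(3)] by simp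
    qed (rule e(1))
    then have "summable (\<lambda>k. dist (x (Suc k)) (x k))"
      using summable_iff_shift[of "\<lambda>k. dist (x (Suc k)) (x k)" N] by (simp only: add_Suc)
    then show ?thesis by (rule conv[OF summable_dist_imp_convergent])
  qed
qed

section \<open>Descent for the difference-of-convex problem\<close>

lemma convex_subdiff_indicator_add:
  assumes "\<eta> \<in> convex_subdiff P x" "x \<in> Q"
  shows "\<eta> \<in> convex_subdiff (\<lambda>y. indicator_fun Q y + P y) x"
proof -
  have x: "x \<in> edom P" and sub: "P y \<ge> P x + ereal (\<eta> \<bullet> (y - x)) - ereal 0" for y
    using assms(1) by (auto simp: eps_subdiff_def)
  have "indicator_fun Q y + P y \<ge> P y" for y
    by (simp add: indicator_fun_def)
  then have "indicator_fun Q y + P y \<ge> P x + ereal (\<eta> \<bullet> (y - x)) - ereal 0" for y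
    using sub order_trans by blast
  then show ?thesis using assms(2) x unfolding eps_subdiff_def by (simp add: indicator_fun_def edom_def)
qed

text \<open>Near \<open>(u, v)\<close> the function splits into a part depending on the first
  coordinate alone, with a convex subgradient, and a part differentiable at \<open>(u, v)\<close>,
  so \<open>frechet_subdiff_add_smooth\<close> applies.\<close>

lemma H_fun_subgradient:
  fixes P f :: "'a::real_inner \<Rightarrow> ereal"
  assumes u: "u \<in> Q" and \<eta>: "\<eta> \<in> convex_subdiff P u" and P: "proper_fun P"
    and f: "proper_fun f" "diff_at f u" and P2: "GDERIV P2 u :> \<xi>"
  shows "(\<eta> + grad f u - \<xi> + \<tau> *\<^sub>R (u - v), \<tau> *\<^sub>R (v - u)) \<in> limiting_subdiff (H_fun \<tau> Q P P2 f) (u, v)"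
proof -
  let ?f = "\<lambda>y. real_of_ereal (f y)"
  define p where "p z = indicator_fun Q (fst z) + P (fst z)" for z :: "'a \<times> 'a"
  define g where "g z = ?f (fst z) - P2 (fst z) + \<tau> / 2 * ((fst z - snd z) \<bullet> (fst z - snd z))" for z
  have "(\<eta>, 0) \<in> convex_subdiff p (u, v)"
    using convex_subdiff_indicator_add[OF \<eta> u] by (auto simp: eps_subdiff_def edom_def p_def)
  moreover have "p (u, v) = ereal (real_of_ereal (P u))"
    using proper_fun_finite[OF P, of u] \<eta> u by (simp add: p_def indicator_fun_def eps_subdiff_def)
  moreover have "GDERIV g (u, v) :> (grad f u - \<xi> + \<tau> *\<^sub>R (u - v), \<tau> *\<^sub>R (v - u))"
  proof -
    have fst: "(fst has_derivative fst) (at (u, v))" and snd: "(snd has_derivative snd) (at (u, v))"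
      by (auto intro: has_derivative_fst[OF has_derivative_ident] has_derivative_snd[OF has_derivative_ident])
    have f': "(?f has_derivative (\<lambda>z. z \<bullet> grad f u)) (at (fst (u, v)))"
      using gderiv_grad[OF f(2)] by (simp add: gderiv_def)
    have P2': "(P2 has_derivative (\<lambda>z. z \<bullet> \<xi>)) (at (fst (u, v)))"
      using P2 by (simp add: gderiv_def)
    show ?thesis unfolding gderiv_def g_def
      by (rule derivative_eq_intros has_derivative_compose[OF fst f'] has_derivative_compose[OF fst P2'] fst snd refl)+
        (auto simp: inner_commute algebra_simps inner_add_right inner_diff_right)
  qed
  moreover have "\<forall>\<^sub>F z in nhds (u, v). H_fun \<tau> Q P P2 f z = p z + ereal (g z)"
  proof -
    \<comment> \<open>On this open set \<open>f\<close> is finite, so \<open>real_of_ereal\<close>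
      inside \<open>g\<close> loses nothing.\<close>
    have "open (interior (edom f) \<times> (UNIV :: 'a set))" by (intro open_Times) auto
    moreover have "(u, v) \<in> interior (edom f) \<times> UNIV" using f(2) by (simp add: diff_at_def)
    ultimately have "\<forall>\<^sub>F z in nhds (u, v). z \<in> interior (edom f) \<times> (UNIV :: 'a set)"
      by (rule eventually_nhds_in_open)
    then show ?thesis
    proof (rule eventually_mono)
      fix z assume "z \<in> interior (edom f) \<times> (UNIV :: 'a set)"
      then have "fst z \<in> edom f" using interior_subset by fastforce
      then obtain r where r: "f (fst z) = ereal r" using proper_fun_finite[OF f(1)] by metis
      show "H_fun \<tau> Q P P2 f z = p z + ereal (g z)"
        unfolding H_fun_def objective_def case_prod_beta p_def g_def r power2_norm_eq_inner
        by (cases "indicator_fun Q (fst z)"; cases "P (fst z)") simp_all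
    qed
  qed
  ultimately have "(\<eta>, 0) + (grad f u - \<xi> + \<tau> *\<^sub>R (u - v), \<tau> *\<^sub>R (v - u)) \<in>
      frechet_subdiff (H_fun \<tau> Q P P2 f) (u, v)"
    by (rule frechet_subdiff_add_smooth)
  then show ?thesis using frechet_subset_limiting_subdiff by (auto simp: algebra_simps)
qed

locale dc_problem =
  fixes Q X N\<^sub>f N\<^sub>\<phi> N\<^sub>S :: "'a::euclidean_space set"
    and f P1 \<phi> :: "'a \<Rightarrow> ereal" and P2 :: "'a \<Rightarrow> real"
    and L \<mu> :: real
  assumes Q: "convex Q" "closure (edom \<phi>) = Q"
    and phi: "proper_fun \<phi>"
    and P1: "proper_fun P1" "convex_fun P1"
    and P2: "continuous_on UNIV P2"
    and f: "proper_fun f" "edom \<phi> \<subseteq> edom f"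
    and X: "edom P1 \<inter> Q \<subseteq> X" "smooth_adaptable L f \<phi> X"
    and lev: "level_bounded (objective Q P1 P2 f)"
    and B: "edom P1 \<inter> Q \<subseteq> N\<^sub>f" "cont_diff_on f N\<^sub>f"
    and C: "edom P1 \<inter> Q \<subseteq> N\<^sub>\<phi>" "N\<^sub>\<phi> \<subseteq> interior (edom \<phi>)"
    and C1: "\<mu> > 0" "strongly_convex_on \<mu> N\<^sub>\<phi> \<phi>"
    and C2: "\<forall>x\<in>N\<^sub>\<phi>. diff_at \<phi> x" "lipschitz_on_bounded_subsets (grad \<phi>) N\<^sub>\<phi>"
    and D1: "lipschitz_on_bounded_subsets (grad f) N\<^sub>f"
    and D2: "open N\<^sub>S" "{x. stationary Q P1 P2 f x} \<subseteq> N\<^sub>S"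
      "cont_diff_on (\<lambda>y. ereal (P2 y)) N\<^sub>S"
      "locally_lipschitz_on (grad (\<lambda>y. ereal (P2 y))) N\<^sub>S"
begin

text \<open>\<open>D\<close> is the effective domain of the objective, and \<open>F\<close> is the
  real-valued form of the objective there. Likewise \<open>breg\<close> represents
  \<open>bregman\<close> for a first argument in \<open>D\<close> and a second in
  \<open>edom \<phi>\<close>; elsewhere \<open>real_of_ereal\<close> may erase infinite
  values.\<close>

abbreviation "D \<equiv> edom P1 \<inter> Q"
definition "F x = real_of_ereal (P1 x) - P2 x + real_of_ereal (f x)"
definition "breg x y = real_of_ereal (\<phi> x) - real_of_ereal (\<phi> y) - grad \<phi> y \<bullet> (x - y)"
abbreviation "sublevel r \<equiv> {x. objective Q P1 P2 f x \<le> ereal r}"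

section \<open>Effective domain and sublevel sets of the objective\<close>

lemma D_edom: "x \<in> D \<Longrightarrow> x \<in> edom \<phi>" "x \<in> D \<Longrightarrow> x \<in> edom f" "x \<in> D \<Longrightarrow> x \<in> edom P1"
  using C f(2) interior_subset by blast+

lemma D_I: "x \<in> edom P1 \<inter> interior (edom \<phi>) \<Longrightarrow> x \<in> D"
  using Q(2) interior_subset closure_subset by blast

text \<open>Convexity of \<open>P1\<close> is given through its epigraph, whose projection is
  \<open>edom P1\<close>.\<close>

lemma convex_D: "convex D"
proof -
  have "edom P1 = fst ` epi P1"
  proof (intro set_eqI iffI)
    fix x assume "x \<in> edom P1"
    then have "(x, real_of_ereal (P1 x)) \<in> epi P1"
      using proper_fun_finite[OF P1(1), of x] by (simp add: epi_def)
    then show "x \<in> fst ` epi P1" by force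
  next
    fix x assume "x \<in> fst ` epi P1"
    then obtain r where "P1 x \<le> ereal r" by (auto simp: epi_def)
    then show "x \<in> edom P1" by (auto simp: edom_def)
  qed
  then have "convex (edom P1)"
    using P1(2) unfolding convex_fun_def by (metis convex_linear_image linear_fst)
  then show ?thesis using Q(1) by (rule convex_Int)
qed

lemma objective_D: "x \<in> D \<Longrightarrow> objective Q P1 P2 f x = ereal (F x)"
proof -
  assume x: "x \<in> D"
  obtain a b where "P1 x = ereal a" "f x = ereal b"
    using proper_fun_finite[OF P1(1) D_edom(3)[OF x]] proper_fun_finite[OF f(1) D_edom(2)[OF x]] by metis
  then show ?thesis using x by (simp add: objective_def indicator_fun_def F_def)
qed

lemma objective_not_D: "x \<notin> D \<Longrightarrow> objective Q P1 P2 f x = \<infinity>"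
  using P1(1) f(1) unfolding objective_def indicator_fun_def proper_fun_def edom_def by auto

lemma sublevel_eq: "sublevel r = {x\<in>D. F x \<le> r}"
proof (intro set_eqI)
  fix x show "x \<in> sublevel r \<longleftrightarrow> x \<in> {x \<in> D. F x \<le> r}"
    using objective_D[of x] objective_not_D[of x] by (cases "x \<in> D") auto
qed

lemma bounded_sublevel: "bounded (sublevel r)"
  using lev by (simp add: level_bounded_def)

text \<open>The quadratic term of \<open>H_fun\<close> vanishes on the diagonal, so the sublevel set
  is the preimage of a closed epigraph under a continuous map.\<close>

lemma closed_sublevel:
  assumes "closed_fun (H_fun \<tau> Q P1 P2 f)"
  shows "closed (sublevel r)"
proof -
  have "sublevel r = (\<lambda>x. ((x, x), r)) -` epi (H_fun \<tau> Q P1 P2 f)"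
    by (auto simp: epi_def H_fun_def zero_ereal_def[symmetric])
  then show ?thesis using assms unfolding closed_fun_def
    by (auto intro!: closed_vimage continuous_intros)
qed

text \<open>If no sublevel set at a height \<open>- real n\<close> were empty, these nested compact
  sets would share a point with \<open>F\<close> below every \<open>- real n\<close>.\<close>

lemma F_bounded_below:
  assumes "closed_fun (H_fun \<tau> Q P1 P2 f)"
  obtains m where "\<And>x. x \<in> D \<Longrightarrow> m \<le> F x"
proof (cases "\<exists>n. sublevel (- real n) = {}")
  case True
  then obtain n where "sublevel (- real n) = {}" by blast
  then have "- real n \<le> F x" if "x \<in> D" for x
    using that unfolding sublevel_eq by (metis (mono_tags, lifting) empty_iff linorder_linear mem_Collect_eq)
  then show ?thesis using that by blast
next
  case False
  have "(\<Inter>n. sublevel (- real n)) \<noteq> {}"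
  proof (rule compact_nest)
    show "compact (sublevel (- real n))" for n
      using closed_sublevel[OF assms] bounded_sublevel by (simp add: compact_eq_bounded_closed)
    show "sublevel (- real n) \<noteq> {}" for n using False by blast
    show "sublevel (- real n) \<subseteq> sublevel (- real m)" if "m \<le> n" for m n
      unfolding sublevel_eq using that by auto
  qed
  then obtain x where x: "\<And>n. F x \<le> - real n" unfolding sublevel_eq by blast
  obtain n where "- F x < real n" using reals_Archimedean2 by blast
  then show ?thesis using x[of n] by simp
qed

section \<open>Bregman distance on the effective domain and the descent inequality\<close>

lemma diff_at_D: "x \<in> D \<Longrightarrow> diff_at \<phi> x" "x \<in> D \<Longrightarrow> diff_at f x"
  using B C(1) C2(1) unfolding cont_diff_on_def by blast+

lemma bregman_D:
  "x \<in> D \<Longrightarrow> y \<in> edom \<phi> \<Longrightarrow> bregman \<phi> x y = ereal (breg x y)"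
  unfolding breg_def using D_edom(1) phi by (intro bregman_ereal)

text \<open>Convexity of \<open>D\<close> keeps the whole segment inside
  \<open>N\<^sub>\<phi>\<close>, where strong convexity is available.\<close>

lemma breg_lower:
  assumes "x \<in> D" "y \<in> D"
  shows "\<mu> / 2 * (dist x y)\<^sup>2 \<le> breg x y"
proof -
  have "closed_segment x y \<subseteq> D" using assms convex_D by (rule closed_segment_subset)
  then have "closed_segment x y \<subseteq> N\<^sub>\<phi>" using C(1) by blast
  moreover have "N\<^sub>\<phi> \<subseteq> edom \<phi>" using C(2) interior_subset by blast
  ultimately show ?thesis
    using strongly_convex_on_gradient_ineq[OF C1(2) _ phi _ diff_at_D(1)[OF assms(2)]]
    by (simp add: breg_def dist_norm algebra_simps)
qed

lemma breg_nonneg: "x \<in> D \<Longrightarrow> y \<in> D \<Longrightarrow> 0 \<le> breg x y"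
  using breg_lower[of x y] C1(1) by (meson divide_nonneg_pos less_imp_le mult_nonneg_nonneg order_trans zero_le_power2 zero_less_numeral)

lemma breg_add: "breg x y + breg y x = (grad \<phi> x - grad \<phi> y) \<bullet> (x - y)"
  by (simp add: breg_def inner_diff_left inner_diff_right)

text \<open>The symmetrized distance is an inner product of differences (\<open>breg_add\<close>);
  dropping the nonnegative \<open>breg y x\<close> leaves Cauchy-Schwarz. Only the endpoints enter,
  which suits sublevel sets that may be nonconvex.\<close>

lemma breg_upper:
  assumes "M-lipschitz_on S (grad \<phi>)" "S \<subseteq> D" "x \<in> S" "y \<in> S"
  shows "breg x y \<le> M * (dist x y)\<^sup>2"
proof -
  have "breg x y \<le> (grad \<phi> x - grad \<phi> y) \<bullet> (x - y)"
    using breg_add[of x y] breg_nonneg[of y x] subsetD[OF assms(2)] assms(3,4) by fastforce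
  also have "\<dots> \<le> norm (grad \<phi> x - grad \<phi> y) * norm (x - y)" by (rule norm_cauchy_schwarz)
  also have "\<dots> \<le> (M * dist x y) * norm (x - y)"
    using lipschitz_onD[OF assms(1,3,4)] by (intro mult_right_mono) (auto simp: dist_norm)
  finally show ?thesis by (simp add: dist_norm power2_eq_square)
qed

text \<open>Sum of three inequalities: the inexact subgradient of \<open>P1\<close> at
  \<open>y\<close> tested at \<open>x\<close>, the subgradient of \<open>P2\<close> at
  \<open>x\<close> tested at \<open>y\<close>, and relative smoothness of \<open>f\<close>. The
  kernel term splits by \<open>breg_add\<close> into both Bregman distances.\<close>

lemma descent:
  assumes x: "x \<in> D" and y: "y \<in> D" and \<xi>: "\<xi> \<in> convex_subdiff (\<lambda>y. ereal (P2 y)) x"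
    and \<eta>: "\<eta> \<in> eps_subdiff \<delta> P1 y"
    and \<Delta>: "\<Delta> = \<eta> + grad f x - \<xi> + \<gamma> *\<^sub>R (grad \<phi> y - grad \<phi> x)"
  shows "F y + (\<gamma> - L) * breg y x + \<gamma> * breg x y \<le> F x + \<bar>\<Delta> \<bullet> (y - x)\<bar> + \<delta>"
proof -
  let ?P = "\<lambda>z. real_of_ereal (P1 z)" and ?f = "\<lambda>z. real_of_ereal (f z)"
  have fin: "P1 x = ereal (?P x)" "P1 y = ereal (?P y)" "f x = ereal (?f x)" "f y = ereal (?f y)"
    using proper_fun_finite[OF P1(1)] proper_fun_finite[OF f(1)] D_edom x y by metis+
  have "P1 x \<ge> P1 y + ereal (\<eta> \<bullet> (x - y)) - ereal \<delta>"
    using \<eta> by (simp add: eps_subdiff_def)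
  then have 1: "?P x \<ge> ?P y + \<eta> \<bullet> (x - y) - \<delta>"
    by (subst (asm) fin(1), subst (asm) fin(2)) simp
  have 2: "P2 y \<ge> P2 x + \<xi> \<bullet> (y - x)"
    using \<xi> by (simp add: eps_subdiff_def)
  have "\<bar>f y - f x - ereal (grad f x \<bullet> (y - x))\<bar> \<le> ereal L * bregman \<phi> y x"
    using X x y C D_edom(1) unfolding smooth_adaptable_def by blast
  then have 3: "?f y - ?f x - grad f x \<bullet> (y - x) \<le> L * breg y x"
    unfolding bregman_D[OF y D_edom(1)[OF x]] by (subst (asm) fin(3), subst (asm) fin(4)) simp
  have 4: "(grad \<phi> y - grad \<phi> x) \<bullet> (y - x) = breg y x + breg x y"
    using breg_add[of y x] by simp
  have "\<eta> \<bullet> (x - y) = - (\<Delta> \<bullet> (y - x)) + grad f x \<bullet> (y - x) - \<xi> \<bullet> (y - x)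
      + \<gamma> * ((grad \<phi> y - grad \<phi> x) \<bullet> (y - x))"
    unfolding \<Delta> by (simp add: algebra_simps inner_add_left inner_diff_left inner_diff_right)
  with 1 2 3 show ?thesis unfolding 4 F_def
    using abs_ge_self[of "\<Delta> \<bullet> (y - x)"] by (simp add: algebra_simps)
qed

end

section \<open>Runs of the algorithm\<close>

text \<open>The level \<open>\<alpha>\<close> involves only the problem data and the two starting
  points, so \<open>M\<close> can be fixed before \<open>\<sigma>\<close>. The first upper bound on
  \<open>\<sigma>\<close> keeps the iterates in the sublevel set, the second makes the merit
  function decrease.\<close>

locale ibpdca_run = dc_problem +
  fixes \<alpha> \<tau> M \<gamma>min \<gamma>max \<sigma> :: real and \<gamma> :: "nat \<Rightarrow> real" and x :: "nat \<Rightarrow> 'a" and xm1 :: 'a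
    and \<xi> \<Delta> :: "nat \<Rightarrow> 'a" and \<delta> :: "nat \<Rightarrow> real"
  assumes gap: "L < \<gamma>min" "0 \<le> L" and \<gamma>: "\<gamma>min \<le> \<gamma> k" "\<gamma> k \<le> \<gamma>max"
    and \<tau>: "\<tau> = (\<gamma>min - L) * \<mu> / 2"
    and KLf: "KL_function (H_fun \<tau> Q P1 P2 f)"
    and \<alpha>: "\<alpha> = F (x 0) + (\<gamma>min - L) * \<bar>breg (x 0) xm1\<bar>"
    and M: "0 \<le> M" "M-lipschitz_on (sublevel \<alpha>) (grad \<phi>)"
    and \<sigma>: "0 \<le> \<sigma>" "\<sigma> * \<gamma>max \<le> \<gamma>min - L" "\<sigma> * \<gamma>max * M \<le> \<tau> / 2"
    and run: "iBPDCA_SC2 f P1 P2 \<phi> \<sigma> \<gamma> (x 0) xm1 x \<xi> \<Delta> \<delta>"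
    and \<delta>: "\<exists>K0. \<forall>k\<ge>K0. \<delta> k = 0"
    and \<Delta>: "summable (\<lambda>k. norm (\<Delta> k))"
begin

section \<open>Iterates, error terms and invariance of the sublevel set\<close>

lemma closed_H: "closed_fun (H_fun \<tau> Q P1 P2 f)"
  using KLf by (simp add: KL_function_def)

lemma \<gamma>_pos: "0 < \<gamma> k" "0 < \<gamma>max" "0 < \<tau>"
proof -
  show "0 < \<gamma> k" "0 < \<gamma>max" using gap \<gamma>[of k] by linarith+
  show "0 < \<tau>" using gap C1(1) unfolding \<tau> by simp
qed

lemma x_D: "x k \<in> D"
proof (rule D_I)
  show "x k \<in> edom P1 \<inter> interior (edom \<phi>)"
    using run unfolding iBPDCA_SC2_def by (cases k) simp_all
qed

lemma \<xi>_subgradient: "\<xi> k \<in> convex_subdiff (\<lambda>y. ereal (P2 y)) (x k)"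
  using run unfolding iBPDCA_SC2_def by blast

text \<open>The approximate subgradient of \<open>P1\<close>, obtained by solving the inexact
  optimality condition for it.\<close>

definition "\<eta> k = \<Delta> k - grad f (x k) + \<xi> k - \<gamma> k *\<^sub>R (grad \<phi> (x (Suc k)) - grad \<phi> (x k))"

lemma \<eta>_subgradient: "\<eta> k \<in> eps_subdiff (\<delta> k) P1 (x (Suc k))"
proof -
  obtain \<eta>' where "\<eta>' \<in> eps_subdiff (\<delta> k) P1 (x (Suc k))"
    "\<Delta> k = \<eta>' + grad f (x k) - \<xi> k + \<gamma> k *\<^sub>R (grad \<phi> (x (Suc k)) - grad \<phi> (x k))"
    using run unfolding iBPDCA_SC2_def by blast
  then show ?thesis by (simp add: \<eta>_def)
qed

lemma previous_edom: "previous xm1 x k \<in> edom \<phi>"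
proof (cases k)
  case 0
  then show ?thesis using run interior_subset unfolding iBPDCA_SC2_def previous_def by auto
next
  case (Suc n)
  then show ?thesis using D_edom(1)[OF x_D] by (simp add: previous_def)
qed

lemma error_bound:
  "\<bar>\<Delta> k \<bullet> (x (Suc k) - x k)\<bar> + \<delta> k \<le> \<sigma> * \<gamma> k * breg (x k) (previous xm1 x k)"
  "0 \<le> \<sigma> * \<gamma> k * breg (x k) (previous xm1 x k)"
proof -
  have "ereal ((norm (\<Delta> k))\<^sup>2 + \<bar>\<Delta> k \<bullet> (x (Suc k) - x k)\<bar> + \<delta> k)
            \<le> ereal (\<sigma> * \<gamma> k) * bregman \<phi> (x k) (previous xm1 x k)" and \<delta>0: "0 \<le> \<delta> k"
    using run unfolding iBPDCA_SC2_def by auto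
  then have *: "(norm (\<Delta> k))\<^sup>2 + \<bar>\<Delta> k \<bullet> (x (Suc k) - x k)\<bar> + \<delta> k \<le> \<sigma> * \<gamma> k * breg (x k) (previous xm1 x k)"
    unfolding bregman_D[OF x_D previous_edom] by simp
  have "0 \<le> (norm (\<Delta> k))\<^sup>2" by simp
  with * \<delta>0 show "\<bar>\<Delta> k \<bullet> (x (Suc k) - x k)\<bar> + \<delta> k \<le> \<sigma> * \<gamma> k * breg (x k) (previous xm1 x k)"
    "0 \<le> \<sigma> * \<gamma> k * breg (x k) (previous xm1 x k)"
    by linarith+
qed

lemma one_step:
  "F (x (Suc k)) + (\<gamma>min - L) * breg (x (Suc k)) (x k)
    \<le> F (x k) + \<sigma> * \<gamma> k * breg (x k) (previous xm1 x k)"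
proof -
  have "F (x (Suc k)) + (\<gamma> k - L) * breg (x (Suc k)) (x k) + \<gamma> k * breg (x k) (x (Suc k))
      \<le> F (x k) + \<bar>\<Delta> k \<bullet> (x (Suc k) - x k)\<bar> + \<delta> k"
    by (rule descent[OF x_D x_D \<xi>_subgradient \<eta>_subgradient]) (simp add: \<eta>_def)
  moreover have "0 \<le> \<gamma> k * breg (x k) (x (Suc k))"
    using \<gamma>_pos(1)[of k] breg_nonneg[OF x_D x_D] by simp
  moreover have "(\<gamma>min - L) * breg (x (Suc k)) (x k) \<le> (\<gamma> k - L) * breg (x (Suc k)) (x k)"
    using \<gamma>(1)[of k] breg_nonneg[OF x_D x_D] by (intro mult_right_mono) auto
  ultimately show ?thesis using error_bound(1)[of k] by linarith
qed

lemma error_coeff: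
  assumes "0 \<le> b"
  shows "\<sigma> * \<gamma> k * b \<le> \<sigma> * \<gamma>max * b"
  using assms \<gamma>(2)[of k] \<sigma>(1) by (intro mult_right_mono mult_left_mono) auto

text \<open>From the second step on the previous iterate lies in \<open>D\<close>, so its distance
  is nonnegative and \<open>\<gamma> (Suc k)\<close> may be raised to
  \<open>\<gamma>max\<close>.\<close>

lemma one_step_Suc:
  "F (x (Suc (Suc k))) + (\<gamma>min - L) * breg (x (Suc (Suc k))) (x (Suc k))
    \<le> F (x (Suc k)) + \<sigma> * \<gamma>max * breg (x (Suc k)) (x k)"
  using one_step[of "Suc k"] error_coeff[OF breg_nonneg[OF x_D x_D], of "Suc k" "Suc k" k]
  by (simp add: previous_def)

text \<open>Since \<open>\<sigma> * \<gamma>max\<close> is at most \<open>\<gamma>min - L\<close>,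
  the error made in one step is paid by the Bregman term gained in the step before.\<close>

lemma lyapunov: "F (x (Suc k)) + (\<gamma>min - L) * breg (x (Suc k)) (x k) \<le> \<alpha>"
proof (induction k)
  case 0
  \<comment> \<open>The point \<open>xm1\<close> is not assumed to lie in \<open>D\<close>, so
    \<open>breg_nonneg\<close> does not cover it; hence the absolute value in
    \<open>\<alpha>\<close>.\<close>
  have "\<sigma> * \<gamma> 0 * breg (x 0) xm1 \<le> \<sigma> * \<gamma> 0 * \<bar>breg (x 0) xm1\<bar>"
    using \<sigma>(1) \<gamma>_pos(1)[of 0] by (intro mult_left_mono) auto
  also have "\<dots> \<le> \<sigma> * \<gamma>max * \<bar>breg (x 0) xm1\<bar>" by (rule error_coeff) simp
  also have "\<dots> \<le> (\<gamma>min - L) * \<bar>breg (x 0) xm1\<bar>" using \<sigma>(2) by (intro mult_right_mono) auto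
  finally show ?case using one_step[of 0] by (simp add: previous_def \<alpha>)
next
  case (Suc k)
  have "\<sigma> * \<gamma>max * breg (x (Suc k)) (x k) \<le> (\<gamma>min - L) * breg (x (Suc k)) (x k)"
    using \<sigma>(2) breg_nonneg[OF x_D x_D] by (intro mult_right_mono) auto
  with one_step_Suc[of k] Suc show ?case by linarith
qed

lemma x_sublevel: "x k \<in> sublevel \<alpha>"
proof -
  have "F (x k) \<le> \<alpha>"
  proof (cases k)
    case 0
    have "0 \<le> (\<gamma>min - L) * \<bar>breg (x 0) xm1\<bar>" using gap by simp
    then show ?thesis using 0 by (simp add: \<alpha>)
  next
    case (Suc n)
    have "0 \<le> (\<gamma>min - L) * breg (x (Suc n)) (x n)" using gap breg_nonneg[OF x_D x_D] by simp
    then show ?thesis using lyapunov[of n] Suc by simp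
  qed
  then show ?thesis unfolding sublevel_eq using x_D by simp
qed

section \<open>Decrease of the merit function along the run\<close>

definition "h k = F (x (Suc k)) + \<tau> / 2 * (dist (x (Suc k)) (x k))\<^sup>2"

text \<open>Strong convexity makes the Bregman gain at least \<open>\<tau>\<close> times the squared
  new step: one half enters \<open>h (Suc k)\<close>, the other is the decrease. The error costs at
  most \<open>\<tau> / 2\<close> times the squared old step, which \<open>h k\<close>
  contains.\<close>

lemma h_descent: "h (Suc k) + \<tau> / 2 * (dist (x (k + 2)) (x (k + 1)))\<^sup>2 \<le> h k"
proof -
  have "\<tau> * (dist (x (Suc (Suc k))) (x (Suc k)))\<^sup>2 \<le> (\<gamma>min - L) * breg (x (Suc (Suc k))) (x (Suc k))"
    using mult_left_mono[OF breg_lower[OF x_D x_D], of "\<gamma>min - L" "Suc (Suc k)" "Suc k"] gap(1)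
    by (simp add: \<tau> algebra_simps)
  moreover have "\<sigma> * \<gamma>max * breg (x (Suc k)) (x k) \<le> \<tau> / 2 * (dist (x (Suc k)) (x k))\<^sup>2"
  proof -
    have "\<sigma> * \<gamma>max * breg (x (Suc k)) (x k) \<le> \<sigma> * \<gamma>max * (M * (dist (x (Suc k)) (x k))\<^sup>2)"
      using \<sigma>(1) \<gamma>_pos(2) x_sublevel sublevel_eq
      by (intro mult_left_mono breg_upper[OF M(2)]) auto
    also have "\<dots> \<le> \<tau> / 2 * (dist (x (Suc k)) (x k))\<^sup>2"
      using mult_right_mono[OF \<sigma>(3), of "(dist (x (Suc k)) (x k))\<^sup>2"] by (simp add: mult.assoc)
    finally show ?thesis .
  qed
  ultimately show ?thesis using one_step_Suc[of k] unfolding h_def by (simp add: field_simps)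
qed

lemma H_fun_x: "H_fun \<tau> Q P1 P2 f (x (Suc k), x k) = ereal (h k)"
  by (simp add: H_fun_def objective_D[OF x_D] h_def dist_norm)

lemma h_convergent: "convergent h"
proof -
  have "decseq h"
  proof (rule decseq_SucI)
    fix k
    have "0 \<le> \<tau> / 2 * (dist (x (k + 2)) (x (k + 1)))\<^sup>2" using \<gamma>_pos(3) by simp
    then show "h (Suc k) \<le> h k" using h_descent[of k] by linarith
  qed
  moreover obtain m where m: "\<And>y. y \<in> D \<Longrightarrow> m \<le> F y" using F_bounded_below[OF closed_H] by blast
  have "m \<le> h k" for k
  proof -
    have "0 \<le> \<tau> / 2 * (dist (x (Suc k)) (x k))\<^sup>2" using \<gamma>_pos(3) by simp
    then show ?thesis using m[OF x_D, of "Suc k"] unfolding h_def by linarith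
  qed
  ultimately show ?thesis by (metis decseq_convergent convergentI)
qed

definition "\<zeta> = lim h"

lemma h_lim: "h \<longlonglongrightarrow> \<zeta>"
  using h_convergent by (simp add: \<zeta>_def convergent_LIMSEQ_iff)

lemma dist_lim: "(\<lambda>k. dist (x (Suc k)) (x k)) \<longlonglongrightarrow> 0"
  by (rule steps_tendsto_0_of_descent[OF h_lim _ h_descent]) (use \<gamma>_pos(3) in simp)

lemma F_lim: "(\<lambda>k. F (x (Suc k))) \<longlonglongrightarrow> \<zeta>"
proof -
  have "(\<lambda>k. h k - \<tau> / 2 * (dist (x (Suc k)) (x k))\<^sup>2) \<longlonglongrightarrow> \<zeta> - \<tau> / 2 * 0\<^sup>2"
    by (intro tendsto_intros h_lim dist_lim)
  then show ?thesis by (simp add: h_def)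
qed

section \<open>Cluster points and limits of subgradients\<close>

lemma compact_sublevel: "compact (sublevel r)"
  using closed_sublevel[OF closed_H] bounded_sublevel by (simp add: compact_eq_bounded_closed)

text \<open>The iterates stay in a ball of radius \<open>R\<close>; the ball of radius
  \<open>R + 1\<close> contains all unit balls around them, and \<open>P2\<close> is bounded on it
  by continuity.\<close>

lemma \<xi>_bounded: "\<exists>R. \<forall>k. norm (\<xi> k) \<le> R"
proof -
  obtain R where R: "\<And>y. y \<in> sublevel \<alpha> \<Longrightarrow> norm y \<le> R"
    using bounded_sublevel unfolding bounded_iff by blast
  have "compact (P2 ` cball 0 (R + 1))"
    using P2 by (intro compact_continuous_image) (auto intro: continuous_on_subset)
  then obtain B where B: "\<And>y. y \<in> cball 0 (R + 1) \<Longrightarrow> \<bar>P2 y\<bar> \<le> B"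
    using compact_imp_bounded[of "P2 ` cball 0 (R + 1)"] unfolding bounded_iff
    by (metis imageI real_norm_def)
  have "norm (\<xi> k) \<le> 2 * B" for k
  proof (rule subgradient_norm_bound[OF \<xi>_subgradient])
    fix y assume "norm (y - x k) \<le> 1"
    then have "norm y \<le> R + 1"
      using norm_triangle_sub[of y "x k"] R[OF x_sublevel, of k] by linarith
    then show "\<bar>P2 y\<bar> \<le> B" by (intro B) simp
  qed
  then show ?thesis by blast
qed

text \<open>Compactness is used for the pairs \<open>(x k, \<xi> k)\<close>, so that one subsequence
  serves both components.\<close>

lemma cluster_point:
  obtains r a b where "strict_mono (r :: nat \<Rightarrow> nat)" "(x \<circ> r) \<longlonglongrightarrow> a" "(\<xi> \<circ> r) \<longlonglongrightarrow> b" "a \<in> D"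
proof -
  obtain R where R: "\<And>k. norm (\<xi> k) \<le> R" using \<xi>_bounded by blast
  have "compact (sublevel \<alpha> \<times> cball (0 :: 'a) R)" 
    by (intro compact_Times compact_sublevel compact_cball)
  moreover have "\<forall>k. (x k, \<xi> k) \<in> sublevel \<alpha> \<times> cball 0 R" using x_sublevel R by simp
  ultimately obtain l r where l: "l \<in> sublevel \<alpha> \<times> cball 0 R" "strict_mono (r :: nat \<Rightarrow> nat)"
    "((\<lambda>k. (x k, \<xi> k)) \<circ> r) \<longlonglongrightarrow> l"
    by (rule seq_compactE[OF compact_imp_seq_compact])
  have "(x \<circ> r) \<longlonglongrightarrow> fst l" "(\<xi> \<circ> r) \<longlonglongrightarrow> snd l"
    using tendsto_fst[OF l(3)] tendsto_snd[OF l(3)] by (simp_all add: o_def)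
  moreover have "fst l \<in> D" using l(1) unfolding sublevel_eq mem_Times_iff by blast
  ultimately show ?thesis using that l(2) by blast
qed

lemma grad_\<phi>_diff: "norm (grad \<phi> (x (Suc k)) - grad \<phi> (x k)) \<le> M * dist (x (Suc k)) (x k)"
  using lipschitz_onD[OF M(2) x_sublevel x_sublevel] by (simp add: dist_norm)

lemma scaled_grad_\<phi>_diff:
  "norm (\<gamma> k *\<^sub>R (grad \<phi> (x (Suc k)) - grad \<phi> (x k))) \<le> \<gamma>max * M * dist (x (Suc k)) (x k)"
proof -
  have "norm (\<gamma> k *\<^sub>R (grad \<phi> (x (Suc k)) - grad \<phi> (x k)))
      = \<gamma> k * norm (grad \<phi> (x (Suc k)) - grad \<phi> (x k))"
    using \<gamma>_pos(1)[of k] by simp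
  also have "\<dots> \<le> \<gamma>max * (M * dist (x (Suc k)) (x k))"
    using \<gamma>_pos(2) \<gamma>(2)[of k] grad_\<phi>_diff[of k] by (intro mult_mono) auto
  finally show ?thesis by (simp add: mult.assoc)
qed

text \<open>As \<open>P1\<close> need not be continuous, the limit of its values is recovered from
  those of \<open>F\<close>, \<open>P2\<close> and \<open>f\<close>. Once
  \<open>F a = \<zeta>\<close> is known, that limit is the value of \<open>P1\<close> at
  \<open>a\<close> and the limiting inequality is a subgradient inequality.\<close>

lemma cluster_point_subgradients:
  assumes r: "strict_mono r" and xr: "(x \<circ> r) \<longlonglongrightarrow> a" and \<xi>r: "(\<xi> \<circ> r) \<longlonglongrightarrow> b" and a: "a \<in> D"
  shows "F a = \<zeta>" "b \<in> convex_subdiff (\<lambda>y. ereal (P2 y)) a" "b - grad f a \<in> convex_subdiff P1 a"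
proof -
  let ?P = "\<lambda>y. real_of_ereal (P1 y)" and ?f = "\<lambda>y. real_of_ereal (f y)"
  \<comment> \<open>The shift by one is needed because \<open>\<eta> (r k)\<close> belongs to the
    point \<open>x (Suc (r k))\<close>; vanishing steps give it the same limit.\<close>
  define y where "y k = x (Suc (r k))" for k
  have yD: "y k \<in> D" for k using x_D by (simp add: y_def)
  have dr: "(\<lambda>k. dist (x (Suc (r k))) (x (r k))) \<longlonglongrightarrow> 0"
    using LIMSEQ_subseq_LIMSEQ[OF dist_lim r] by (simp add: o_def)
  then have "(\<lambda>k. x (Suc (r k)) - x (r k)) \<longlonglongrightarrow> 0"
    unfolding dist_norm by (rule tendsto_norm_zero_cancel)
  from tendsto_add[OF this xr] have ylim: "y \<longlonglongrightarrow> a" by (simp add: y_def[abs_def] o_def)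
  have P2cont: "isCont P2 z" for z using P2 by (simp add: continuous_on_eq_continuous_at)
  have fcont: "isCont ?f a"
    using gderiv_grad[OF diff_at_D(2)[OF a]] unfolding gderiv_def by (rule has_derivative_continuous)
  have P2y: "(\<lambda>k. P2 (y k)) \<longlonglongrightarrow> P2 a" using P2cont ylim by (rule isCont_tendsto_compose)
  have fy: "(\<lambda>k. ?f (y k)) \<longlonglongrightarrow> ?f a" using fcont ylim by (rule isCont_tendsto_compose)
  have Fy: "(\<lambda>k. F (y k)) \<longlonglongrightarrow> \<zeta>"
    using LIMSEQ_subseq_LIMSEQ[OF F_lim r] by (simp add: o_def y_def)
  have Py: "(\<lambda>k. ?P (y k)) \<longlonglongrightarrow> \<zeta> + P2 a - ?f a"
  proof -
    have "(\<lambda>k. F (y k) + P2 (y k) - ?f (y k)) \<longlonglongrightarrow> \<zeta> + P2 a - ?f a"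
      by (intro tendsto_intros Fy P2y fy)
    then show ?thesis by (simp add: F_def)
  qed
  show bsub: "b \<in> convex_subdiff (\<lambda>y. ereal (P2 y)) a"
  proof -
    have "P2 z \<ge> P2 a + b \<bullet> (z - a)" for z
    proof (rule LIMSEQ_le_const2)
      show "(\<lambda>k. P2 (x (r k)) + \<xi> (r k) \<bullet> (z - x (r k))) \<longlonglongrightarrow> P2 a + b \<bullet> (z - a)"
        using xr \<xi>r isCont_tendsto_compose[OF P2cont xr] unfolding o_def by (intro tendsto_intros)
      show "\<exists>N. \<forall>n\<ge>N. P2 (x (r n)) + \<xi> (r n) \<bullet> (z - x (r n)) \<le> P2 z"
        using \<xi>_subgradient by (auto simp: eps_subdiff_def)
    qed
    then show ?thesis by (simp add: eps_subdiff_def edom_def)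
  qed
  have gf: "(\<lambda>k. grad f (x (r k))) \<longlonglongrightarrow> grad f a"
  proof -
    have "continuous_on N\<^sub>f (grad f)" using B(2) by (simp add: cont_diff_on_def)
    moreover have "(\<lambda>k. x (r k)) \<longlonglongrightarrow> a" using xr by (simp add: o_def)
    moreover have "a \<in> N\<^sub>f" using a B(1) by blast
    moreover have "\<forall>\<^sub>F k in sequentially. x (r k) \<in> N\<^sub>f"
      using subsetD[OF B(1) x_D] by (intro always_eventually allI)
    ultimately show ?thesis by (rule continuous_on_tendsto_compose)
  qed
  have \<Delta>r: "(\<lambda>k. \<Delta> (r k)) \<longlonglongrightarrow> 0"
    using LIMSEQ_subseq_LIMSEQ[OF tendsto_norm_zero_cancel[OF summable_LIMSEQ_zero[OF \<Delta>]] r]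
    by (simp add: o_def)
  have \<phi>r: "(\<lambda>k. \<gamma> (r k) *\<^sub>R (grad \<phi> (x (Suc (r k))) - grad \<phi> (x (r k)))) \<longlonglongrightarrow> 0"
  proof (rule Lim_null_comparison)
    show "\<forall>\<^sub>F k in sequentially. norm (\<gamma> (r k) *\<^sub>R (grad \<phi> (x (Suc (r k))) - grad \<phi> (x (r k))))
        \<le> \<gamma>max * M * dist (x (Suc (r k))) (x (r k))"
      by (intro always_eventually allI scaled_grad_\<phi>_diff)
    show "(\<lambda>k. \<gamma>max * M * dist (x (Suc (r k))) (x (r k))) \<longlonglongrightarrow> 0"
      by (rule tendsto_mult_right_zero[OF dr])
  qed
  have "(\<lambda>k. \<Delta> (r k) - grad f (x (r k)) + \<xi> (r k)
      - \<gamma> (r k) *\<^sub>R (grad \<phi> (x (Suc (r k))) - grad \<phi> (x (r k)))) \<longlonglongrightarrow> 0 - grad f a + b - 0"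
    using \<xi>r by (intro tendsto_intros \<Delta>r gf \<phi>r) (simp add: o_def)
  then have \<eta>r: "(\<lambda>k. \<eta> (r k)) \<longlonglongrightarrow> b - grad f a" by (simp add: \<eta>_def)
  \<comment> \<open>From \<open>K0\<close> on the errors \<open>\<delta>\<close> vanish, so the
    approximate subgradients are exact.\<close>
  obtain K0 where K0: "\<And>k. k \<ge> K0 \<Longrightarrow> \<delta> k = 0" using \<delta> by blast
  have sub: "?P z \<ge> \<zeta> + P2 a - ?f a + (b - grad f a) \<bullet> (z - a)" if z: "z \<in> edom P1" for z
  proof (rule LIMSEQ_le_const2)
    show "(\<lambda>k. ?P (y k) + \<eta> (r k) \<bullet> (z - y k)) \<longlonglongrightarrow> \<zeta> + P2 a - ?f a + (b - grad f a) \<bullet> (z - a)"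
      by (intro tendsto_intros Py \<eta>r ylim)
    show "\<exists>N. \<forall>n\<ge>N. ?P (y n) + \<eta> (r n) \<bullet> (z - y n) \<le> ?P z"
    proof (intro exI allI impI)
      fix n assume "n \<ge> K0"
      then have "\<delta> (r n) = 0" using K0 seq_suble[OF r, of n] order_trans by blast
      then have "\<eta> (r n) \<in> convex_subdiff P1 (y n)" using \<eta>_subgradient[of "r n"] by (simp add: y_def)
      then have "P1 (y n) + ereal (\<eta> (r n) \<bullet> (z - y n)) - ereal 0 \<le> P1 z"
        by (simp add: eps_subdiff_def)
      then show "?P (y n) + \<eta> (r n) \<bullet> (z - y n) \<le> ?P z"
        by (subst (asm) proper_fun_finite[OF P1(1) D_edom(3)[OF yD]],
            subst (asm) proper_fun_finite[OF P1(1) z]) simp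
    qed
  qed
  \<comment> \<open>The limiting inequality tested at \<open>a\<close> itself; the converse below is
    lower semicontinuity, in the form of closed sublevel sets.\<close>
  have "\<zeta> \<le> F a" using sub[OF D_edom(3)[OF a]] by (simp add: F_def)
  moreover have "F a \<le> \<zeta>"
  proof (rule field_le_epsilon)
    fix e :: real assume "0 < e"
    then have "\<forall>\<^sub>F k in sequentially. F (y k) < \<zeta> + e" using Fy by (intro order_tendstoD) auto
    then have "\<forall>\<^sub>F k in sequentially. y k \<in> sublevel (\<zeta> + e)"
      unfolding sublevel_eq using yD by (auto elim: eventually_mono)
    then have "a \<in> sublevel (\<zeta> + e)"
      using closed_sublevel[OF closed_H] ylim by (intro Lim_in_closed_set) auto
    then show "F a \<le> \<zeta> + e" unfolding sublevel_eq by simp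
  qed
  ultimately show Fa: "F a = \<zeta>" by simp
  then have Pa: "\<zeta> + P2 a - ?f a = ?P a" by (simp add: F_def)
  have "P1 z \<ge> P1 a + ereal ((b - grad f a) \<bullet> (z - a)) - ereal 0" for z
  proof (cases "z \<in> edom P1")
    case True
    show ?thesis
      by (subst proper_fun_finite[OF P1(1) D_edom(3)[OF a]], subst proper_fun_finite[OF P1(1) True])
        (use sub[OF True] Pa in simp)
  next
    case False
    then show ?thesis by (simp add: edom_def)
  qed
  then show "b - grad f a \<in> convex_subdiff P1 a"
    using D_edom(3)[OF a] by (simp add: eps_subdiff_def)
qed

section \<open>Convergence of the whole sequence\<close>

theorem converges_to_l_stationary: "\<exists>a. x \<longlonglongrightarrow> a \<and> l_stationary Q P1 P2 f a"
proof -
  let ?gP = "grad (\<lambda>y. ereal (P2 y))"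
  obtain r a b where r: "strict_mono (r :: nat \<Rightarrow> nat)" "(x \<circ> r) \<longlonglongrightarrow> a" "(\<xi> \<circ> r) \<longlonglongrightarrow> b"
    and a: "a \<in> D" by (rule cluster_point)
  note Fa = cluster_point_subgradients(1)[OF r a] and bP2 = cluster_point_subgradients(2)[OF r a]
    and bP1 = cluster_point_subgradients(3)[OF r a]
  have \<eta>a: "b - grad f a \<in> convex_subdiff (\<lambda>y. indicator_fun Q y + P1 y) a"
    using convex_subdiff_indicator_add[OF bP1] a by blast
  then have "stationary Q P1 P2 f a" unfolding stationary_def using bP2 by force
  then have aN: "a \<in> N\<^sub>S" using D2(2) by blast
  have gP2: "GDERIV P2 z :> ?gP z" if "z \<in> N\<^sub>S" for z
    using D2(3) that gderiv_grad[of "\<lambda>y. ereal (P2 y)" z] by (simp add: cont_diff_on_def)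
  have b: "b = ?gP a" using subgradient_eq_gradient[OF bP2 gP2[OF aN]] .
  have lst: "l_stationary Q P1 P2 f a"
    unfolding l_stationary_def using D2(1,3) aN \<eta>a b by force
  \<comment> \<open>The KL property is granted only where the limiting subdifferential is nonempty,
    so a subgradient at \<open>(a, a)\<close> is exhibited.\<close>
  have "limiting_subdiff (H_fun \<tau> Q P1 P2 f) (a, a) \<noteq> {}"
    using H_fun_subgradient[OF _ bP1 P1(1) f(1) diff_at_D(2)[OF a] gP2[OF aN]] a by blast
  then have KL: "KL_property_at (H_fun \<tau> Q P1 P2 f) (a, a)"
    using KLf by (simp add: KL_function_def)
  \<comment> \<open>The gradient of \<open>P2\<close> is Lipschitz only locally; this confines the
    subgradient bound to iterates near \<open>a\<close>.\<close>
  obtain \<epsilon>1 M2 where \<epsilon>1: "0 < \<epsilon>1" and M2: "M2-lipschitz_on (ball a \<epsilon>1 \<inter> N\<^sub>S) ?gP"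
    using D2(4) aN unfolding locally_lipschitz_on_def by blast
  obtain \<epsilon>2 where \<epsilon>2: "0 < \<epsilon>2" "ball a \<epsilon>2 \<subseteq> N\<^sub>S" using D2(1) aN open_contains_ball by blast
  define \<rho> where "\<rho> = min \<epsilon>1 \<epsilon>2"
  have \<rho>: "0 < \<rho>" "ball a \<rho> \<subseteq> ball a \<epsilon>1 \<inter> N\<^sub>S"
    using \<epsilon>1 \<epsilon>2 by (auto simp: \<rho>_def)
  have "sublevel \<alpha> \<subseteq> N\<^sub>f" unfolding sublevel_eq using B(1) by blast
  then obtain M1 where M1: "M1-lipschitz_on (sublevel \<alpha>) (grad f)"
    using D1 bounded_sublevel unfolding lipschitz_on_bounded_subsets_def by blast
  \<comment> \<open>The 1 accounts for \<open>\<Delta>\<close>, then come the Lipschitz constants of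
    the gradients of \<open>f\<close>, \<open>P2\<close> and the scaled kernel, and
    \<open>\<tau>\<close> once for each component of the quadratic term.\<close>
  define C where "C = 1 + M1 + M2 + \<gamma>max * M + 2 * \<tau>"
  have nonneg: "0 \<le> M1" "0 \<le> M2" "0 \<le> \<gamma>max * M" "0 < \<tau>"
    using lipschitz_on_nonneg[OF M1] lipschitz_on_nonneg[OF M2] \<gamma>_pos M(1) by auto
  obtain K0 where K0: "\<And>k. k \<ge> K0 \<Longrightarrow> \<delta> k = 0" using \<delta> by blast
  have bound: "\<exists>w\<in>limiting_subdiff (H_fun \<tau> Q P1 P2 f) (x (Suc k), x k).
      norm w \<le> C * (dist (x (Suc k)) (x k) + norm (\<Delta> k))"
    if k: "k \<ge> K0" and near: "x k \<in> ball a \<rho>" "x (Suc k) \<in> ball a \<rho>" for k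
  proof -
    let ?d = "dist (x (Suc k)) (x k)"
    have nearN: "x k \<in> ball a \<epsilon>1 \<inter> N\<^sub>S" "x (Suc k) \<in> ball a \<epsilon>1 \<inter> N\<^sub>S" using near \<rho>(2) by blast+
    \<comment> \<open>Near \<open>a\<close> the arbitrary choice of \<open>\<xi> k\<close> is forced
      to be the gradient, so only gradient differences remain.\<close>
    have "\<xi> k = ?gP (x k)"
      using subgradient_eq_gradient[OF \<xi>_subgradient gP2] nearN by blast
    then have \<eta>k: "\<eta> k + grad f (x (Suc k)) - ?gP (x (Suc k)) = \<Delta> k + (grad f (x (Suc k)) - grad f (x k))
        + (?gP (x k) - ?gP (x (Suc k))) - \<gamma> k *\<^sub>R (grad \<phi> (x (Suc k)) - grad \<phi> (x k))"
      by (simp add: \<eta>_def)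
    have norm4: "norm (p + q + s - t) \<le> norm p + norm q + norm s + norm t" for p q s t :: 'a
      by norm
    have "norm (grad f (x (Suc k)) - grad f (x k)) \<le> M1 * ?d"
      using lipschitz_onD[OF M1 x_sublevel x_sublevel] by (simp add: dist_norm)
    moreover have "norm (?gP (x k) - ?gP (x (Suc k))) \<le> M2 * ?d"
      using lipschitz_onD[OF M2 nearN(2,1)] by (simp add: dist_norm norm_minus_commute)
    ultimately have first: "norm (\<eta> k + grad f (x (Suc k)) - ?gP (x (Suc k)))
        \<le> norm (\<Delta> k) + M1 * ?d + M2 * ?d + \<gamma>max * M * ?d"
      using scaled_grad_\<phi>_diff[of k] norm4 unfolding \<eta>k by (meson add_mono order_refl order_trans)
    let ?w = "(\<eta> k + grad f (x (Suc k)) - ?gP (x (Suc k)) + \<tau> *\<^sub>R (x (Suc k) - x k), \<tau> *\<^sub>R (x k - x (Suc k)))"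
    have "\<eta> k \<in> convex_subdiff P1 (x (Suc k))" using \<eta>_subgradient[of k] K0[OF k] by simp
    then have "?w \<in> limiting_subdiff (H_fun \<tau> Q P1 P2 f) (x (Suc k), x k)"
      using x_D[of "Suc k"] nearN(2)
      by (intro H_fun_subgradient P1 f diff_at_D gP2) auto
    moreover have "norm ?w \<le> C * (?d + norm (\<Delta> k))"
    proof -
      have "norm ?w \<le> norm (\<eta> k + grad f (x (Suc k)) - ?gP (x (Suc k)) + \<tau> *\<^sub>R (x (Suc k) - x k))
          + norm (\<tau> *\<^sub>R (x k - x (Suc k)))"
        by (rule norm_Pair_le)
      also have "\<dots> \<le> norm (\<Delta> k) + M1 * ?d + M2 * ?d + \<gamma>max * M * ?d + \<tau> * ?d + \<tau> * ?d"
        using first nonneg(4)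
        by (intro add_mono order_trans[OF norm_triangle_ineq]) (auto simp: dist_norm norm_minus_commute)
      also have "\<dots> = (C - 1) * ?d + 1 * norm (\<Delta> k)" by (simp add: C_def algebra_simps)
      also have "\<dots> \<le> C * ?d + C * norm (\<Delta> k)"
        using nonneg by (intro add_mono mult_right_mono) (auto simp: C_def)
      finally show ?thesis by (simp add: distrib_left)
    qed
    ultimately show ?thesis by blast
  qed
  have "x \<longlonglongrightarrow> a"
  proof (rule KL_convergence[OF KL H_fun_x _ h_lim _ h_descent r(1,2) _ \<rho>(1)])
    show "H_fun \<tau> Q P1 P2 f (a, a) = ereal \<zeta>" by (simp add: H_fun_def objective_D[OF a] Fa)
    show "0 < \<tau> / 2" using nonneg by simp
    show "0 < C" using nonneg by (simp add: C_def)
    show "\<forall>\<^sub>F k in sequentially. x k \<in> ball a \<rho> \<longrightarrow> x (Suc k) \<in> ball a \<rho> \<longrightarrow>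
      (\<exists>w\<in>limiting_subdiff (H_fun \<tau> Q P1 P2 f) (x (Suc k), x k).
        norm w \<le> C * (dist (x (Suc k)) (x k) + norm (\<Delta> k)))"
      using bound unfolding eventually_sequentially by blast
    show "summable (\<lambda>k. norm (\<Delta> k))" by (rule \<Delta>)
  qed simp
  with lst show ?thesis by blast
qed

end

section \<open>A threshold for \<open>\<sigma>\<close> that is uniform over all runs\<close>

theorem theorem4p3:
  fixes Q X N\<^sub>f N\<^sub>\<phi> N\<^sub>S :: "'a::euclidean_space set"
    and f P1 \<phi> :: "'a \<Rightarrow> ereal" and P2 :: "'a \<Rightarrow> real"
    and L \<mu> \<gamma>min \<gamma>max :: real
    and x0 xm1 :: 'a
  assumes Q: "closed Q" "convex Q" "interior Q \<noteq> {}"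
    and phi: "proper_fun \<phi>" "closed_fun \<phi>"
    and A1: "essentially_smooth \<phi>" "strictly_convex_on (edom \<phi>) \<phi>" "closure (edom \<phi>) = Q"
    and A2: "proper_fun P1" "closed_fun P1" "convex_fun P1" "edom P1 \<inter> interior Q \<noteq> {}"
      "continuous_on UNIV P2" "convex_on UNIV P2"
    and A3: "proper_fun f" "closed_fun f" "edom \<phi> \<subseteq> edom f"
      "cont_diff_on f (interior (edom f))"
      "closed X" "edom P1 \<inter> Q \<subseteq> X" "L \<ge> 0" "smooth_adaptable L f \<phi> X"
    and A4: "level_bounded (objective Q P1 P2 f)"
    and B: "open N\<^sub>f" "edom P1 \<inter> Q \<subseteq> N\<^sub>f" "cont_diff_on f N\<^sub>f"
    and C: "open N\<^sub>\<phi>" "edom P1 \<inter> Q \<subseteq> N\<^sub>\<phi>" "N\<^sub>\<phi> \<subseteq> interior (edom \<phi>)"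
    and C1: "\<mu> > 0" "strongly_convex_on \<mu> N\<^sub>\<phi> \<phi>"
    and C2: "\<forall>x\<in>N\<^sub>\<phi>. diff_at \<phi> x" "lipschitz_on_bounded_subsets (grad \<phi>) N\<^sub>\<phi>"
    and D1: "lipschitz_on_bounded_subsets (grad f) N\<^sub>f"
    and D2: "open N\<^sub>S" "{x. stationary Q P1 P2 f x} \<subseteq> N\<^sub>S"
      "cont_diff_on (\<lambda>y. ereal (P2 y)) N\<^sub>S"
      "locally_lipschitz_on (grad (\<lambda>y. ereal (P2 y))) N\<^sub>S"
    and gamma: "L < \<gamma>min"
    and init: "x0 \<in> edom P1 \<inter> interior (edom \<phi>)" "xm1 \<in> interior (edom \<phi>)"
    and KL: "\<forall>\<tau>>0. KL_function (H_fun \<tau> Q P1 P2 f)"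
  shows "\<exists>\<sigma>0>0. \<forall>(\<sigma>::real) (\<gamma> :: nat \<Rightarrow> real) (x :: nat \<Rightarrow> 'a) (\<xi> :: nat \<Rightarrow> 'a)
            (\<Delta> :: nat \<Rightarrow> 'a) (\<delta> :: nat \<Rightarrow> real).
      0 \<le> \<sigma> \<and> \<sigma> < (\<gamma>min - L) / \<gamma>max \<and> \<sigma> < \<sigma>0 \<and>
      (\<forall>k. \<gamma>min \<le> \<gamma> k \<and> \<gamma> k \<le> \<gamma>max) \<and>
      iBPDCA_SC2 f P1 P2 \<phi> \<sigma> \<gamma> x0 xm1 x \<xi> \<Delta> \<delta> \<and>
      (\<forall>k. subproblem_solvable f P1 \<phi> (x k) (\<xi> k) (\<gamma> k)) \<and>
      (\<exists>K0>0. \<forall>k\<ge>K0. \<delta> k = 0) \<and>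
      summable (\<lambda>k. norm (\<Delta> k))
      \<longrightarrow> (\<exists>xs. x \<longlonglongrightarrow> xs \<and> l_stationary Q P1 P2 f xs)"
proof -
  interpret dc_problem Q X N\<^sub>f N\<^sub>\<phi> N\<^sub>S f P1 \<phi> P2 L \<mu>
    by unfold_locales (use Q phi A1 A2 A3 A4 B C C1 C2 D1 D2 in blast)+
  define \<tau> where "\<tau> = (\<gamma>min - L) * \<mu> / 2"
  \<comment> \<open>The threshold is quantified before the run, so \<open>\<alpha>\<close> and then
    \<open>M\<close> may depend on \<open>x0\<close> and \<open>xm1\<close> but not on later
    iterates.\<close>
  define \<alpha> where "\<alpha> = F x0 + (\<gamma>min - L) * \<bar>breg x0 xm1\<bar>"
  have \<tau>: "0 < \<tau>" using gamma C1(1) by (simp add: \<tau>_def)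
  have "sublevel \<alpha> \<subseteq> N\<^sub>\<phi>" unfolding sublevel_eq
    using \<open>edom P1 \<inter> Q \<subseteq> N\<^sub>\<phi>\<close> by blast
  then obtain M where M: "M-lipschitz_on (sublevel \<alpha>) (grad \<phi>)"
    using C2(2) bounded_sublevel unfolding lipschitz_on_bounded_subsets_def by blast
  have M0: "0 \<le> M" by (rule lipschitz_on_nonneg[OF M])
  \<comment> \<open>\<open>\<sigma> < \<tau> / c\<close> is to imply
    \<open>\<sigma> * \<gamma>max * M \<le> \<tau> / 2\<close>. The maximum and \<open>M + 1\<close>
    keep \<open>c\<close> positive: \<open>M\<close> may be 0, and \<open>0 < \<gamma>max\<close>
    follows only once some \<open>\<gamma> k\<close> lies between the bounds.\<close>
  define c where "c = 2 * max 1 \<gamma>max * (M + 1)"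
  have c: "0 < c" using M0 by (simp add: c_def)
  show ?thesis
  proof (intro exI[of _ "\<tau> / c"] conjI allI impI)
    show "0 < \<tau> / c" using \<tau> c by simp
  next
    fix \<sigma> :: real and \<gamma> :: "nat \<Rightarrow> real" and x \<xi> \<Delta> :: "nat \<Rightarrow> 'a" and \<delta> :: "nat \<Rightarrow> real"
    assume *: "0 \<le> \<sigma> \<and> \<sigma> < (\<gamma>min - L) / \<gamma>max \<and> \<sigma> < \<tau> / c \<and>
      (\<forall>k. \<gamma>min \<le> \<gamma> k \<and> \<gamma> k \<le> \<gamma>max) \<and>
      iBPDCA_SC2 f P1 P2 \<phi> \<sigma> \<gamma> x0 xm1 x \<xi> \<Delta> \<delta> \<and>
      (\<forall>k. subproblem_solvable f P1 \<phi> (x k) (\<xi> k) (\<gamma> k)) \<and>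
      (\<exists>K0>0. \<forall>k\<ge>K0. \<delta> k = 0) \<and> summable (\<lambda>k. norm (\<Delta> k))"
    then have x0: "x 0 = x0" by (simp add: iBPDCA_SC2_def)
    have \<gamma>max: "0 < \<gamma>max" using * gamma A3(7) by (meson le_less_trans less_le_trans)
    have \<sigma>1: "\<sigma> * \<gamma>max \<le> \<gamma>min - L" using * \<gamma>max by (simp add: field_simps)
    have "\<sigma> * \<gamma>max * M \<le> \<sigma> * (max 1 \<gamma>max * (M + 1))"
      unfolding mult.assoc using * M0 \<gamma>max by (intro mult_left_mono mult_mono) auto
    also have "\<dots> = \<sigma> * c / 2" by (simp add: c_def)
    also have "\<dots> \<le> \<tau> / 2" using * c by (simp add: field_simps)
    finally have \<sigma>2: "\<sigma> * \<gamma>max * M \<le> \<tau> / 2" .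
    interpret ibpdca_run Q X N\<^sub>f N\<^sub>\<phi> N\<^sub>S f P1 \<phi> P2 L \<mu> \<alpha> \<tau> M \<gamma>min \<gamma>max \<sigma> \<gamma> x xm1 \<xi> \<Delta> \<delta>
      by unfold_locales
        (use * gamma A3(7) \<tau> KL M M0 \<sigma>1 \<sigma>2 in \<open>auto simp: x0 \<alpha>_def \<tau>_def\<close>)
    show "\<exists>xs. x \<longlonglongrightarrow> xs \<and> l_stationary Q P1 P2 f xs" by (rule converges_to_l_stationary)
  qed
qed

end
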